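(* Let $1\le s\le r$ be integers and let $X$ be a compact Hausdorff space with $X\simeq_2\mathbb{C}H_{r,s}$, equipped with a free $\mathbb{Z}_2$-action. Then $\mathrm{g}_{\mathrm{free}}(X,\mathbb{Z}_2)\ge 3$. In particular, there does not exist any $\mathbb{Z}_2$-equivariant map $X\to\mathbb{S}^1$, where $\mathbb{S}^1$ carries the antipodal involution.
   Context: For integers $0\le s\le r$, the complex Milnor manifold is $$\mathbb{C}H_{r,s}=\{([z_0,\dots,z_r],[w_0,\dots,w_s])\in\mathbb{C}P^r\times\mathbb{C}P^s : z_0\overline{w}_0+\cdots+z_s\overline{w}_s=0\}.$$ For spaces $X$ and $Y$, $X\simeq_2 Y$ means that the graded algebras $H^*(X;\mathbb{Z}_2)$ and $H^*(Y;\mathbb{Z}_2)$ are isomorphic (not necessarily via a map between $X$ and $Y$). For a finite group $G$ and a paracompact space $X$ with a free $G$-action, the Schwarz genus $\mathrm{g}_{\mathrm{free}}(X,G)$ is the smallest $n$ such that there exists a $G$-equivariant map $X\to G*\cdots*G$ into the $n$-fold join of $G$ (with $G$ regarded as a $0$-dimensional simplicial complex) equipped with the diagonal $G$-action. For $G=\mathbb{Z}_2$ this is the least $n$ for which there is a $\mathbb{Z}_2$-equivariant map $X\to\mathbb{S}^{n-1}$, where $\mathbb{S}^{n-1}$ has the antipodal involution. *)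

theory Defs
  imports
    "HOL-Analysis.Analysis"
    "HOL-Homology.Homology"
    "HOL-Algebra.Group_Action"
    "HOL-Algebra.Elementary_Groups"
    "HOL-Library.Z2"
    "HOL-Library.Extended_Nat"
begin

section \<open>Singular cohomology algebra with coefficients in the two-element field\<close>

text \<open>A cochain is a function on singular simplices. It is normalised to be 0 on everything
  that is not a singular simplex of the right dimension, so that equal cochains are equal functions.\<close>

definition cochains :: "nat \<Rightarrow> 'a topology \<Rightarrow> (((nat \<Rightarrow> real) \<Rightarrow> 'a) \<Rightarrow> bit) set" where
  "cochains p X = {c. \<forall>\<sigma>. \<not> singular_simplex p X \<sigma> \<longrightarrow> c \<sigma> = 0}"

text \<open>No signs are needed in characteristic 2.\<close>

definition coboundary ::
  "nat \<Rightarrow> 'a topology \<Rightarrow> (((nat \<Rightarrow> real) \<Rightarrow> 'a) \<Rightarrow> bit) \<Rightarrow> ((nat \<Rightarrow> real) \<Rightarrow> 'a) \<Rightarrow> bit" where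
  "coboundary p X c =
     (\<lambda>\<sigma>. if singular_simplex (Suc p) X \<sigma> then \<Sum>k\<le>Suc p. c (singular_face (Suc p) k \<sigma>) else 0)"

definition cocycles :: "nat \<Rightarrow> 'a topology \<Rightarrow> (((nat \<Rightarrow> real) \<Rightarrow> 'a) \<Rightarrow> bit) set" where
  "cocycles p X = {c \<in> cochains p X. coboundary p X c = (\<lambda>_. 0)}"

definition coboundaries :: "nat \<Rightarrow> 'a topology \<Rightarrow> (((nat \<Rightarrow> real) \<Rightarrow> 'a) \<Rightarrow> bit) set" where
  "coboundaries p X =
     (case p of 0 \<Rightarrow> {\<lambda>_. 0} | Suc q \<Rightarrow> coboundary q X ` cochains q X)"

definition cocycle_group :: "nat \<Rightarrow> 'a topology \<Rightarrow> (((nat \<Rightarrow> real) \<Rightarrow> 'a) \<Rightarrow> bit) monoid" where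
  "cocycle_group p X =
     \<lparr>carrier = cocycles p X, monoid.mult = (\<lambda>c d \<sigma>. c \<sigma> + d \<sigma>), one = (\<lambda>_. 0)\<rparr>"

definition cohomology_group ::
  "nat \<Rightarrow> 'a topology \<Rightarrow> (((nat \<Rightarrow> real) \<Rightarrow> 'a) \<Rightarrow> bit) set monoid" where
  "cohomology_group p X = cocycle_group p X Mod coboundaries p X"

definition cohomology_class ::
  "nat \<Rightarrow> 'a topology \<Rightarrow> (((nat \<Rightarrow> real) \<Rightarrow> 'a) \<Rightarrow> bit) \<Rightarrow> (((nat \<Rightarrow> real) \<Rightarrow> 'a) \<Rightarrow> bit) set" where
  "cohomology_class p X c = coboundaries p X #>\<^bsub>cocycle_group p X\<^esub> c"

text \<open>Restriction of a singular (p+q)-simplex to its first p+1 and to its last q+1 vertices;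
  the former uses that the standard p-simplex is literally a subset of the (p+q)-simplex.\<close>

definition front_face :: "nat \<Rightarrow> ((nat \<Rightarrow> real) \<Rightarrow> 'a) \<Rightarrow> (nat \<Rightarrow> real) \<Rightarrow> 'a" where
  "front_face p \<sigma> = restrict \<sigma> (standard_simplex p)"

definition back_face :: "nat \<Rightarrow> nat \<Rightarrow> ((nat \<Rightarrow> real) \<Rightarrow> 'a) \<Rightarrow> (nat \<Rightarrow> real) \<Rightarrow> 'a" where
  "back_face p q \<sigma> = (\<lambda>x\<in>standard_simplex q. \<sigma> (\<lambda>i. if i < p then 0 else x (i - p)))"

definition cochain_cup ::
  "nat \<Rightarrow> nat \<Rightarrow> 'a topology \<Rightarrow> (((nat \<Rightarrow> real) \<Rightarrow> 'a) \<Rightarrow> bit) \<Rightarrow> (((nat \<Rightarrow> real) \<Rightarrow> 'a) \<Rightarrow> bit)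
     \<Rightarrow> ((nat \<Rightarrow> real) \<Rightarrow> 'a) \<Rightarrow> bit" where
  "cochain_cup p q X a b =
     (\<lambda>\<sigma>. if singular_simplex (p + q) X \<sigma> then a (front_face p \<sigma>) * b (back_face p q \<sigma>) else 0)"

text \<open>The union below runs over all representatives; as the class of the product
  does not depend on them, it is a single class.\<close>

definition cup_product ::
  "nat \<Rightarrow> nat \<Rightarrow> 'a topology \<Rightarrow> (((nat \<Rightarrow> real) \<Rightarrow> 'a) \<Rightarrow> bit) set \<Rightarrow> (((nat \<Rightarrow> real) \<Rightarrow> 'a) \<Rightarrow> bit) set
     \<Rightarrow> (((nat \<Rightarrow> real) \<Rightarrow> 'a) \<Rightarrow> bit) set" where
  "cup_product p q X A B = (\<Union>a\<in>A. \<Union>b\<in>B. cohomology_class (p + q) X (cochain_cup p q X a b))"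

definition cohomology_unit :: "'a topology \<Rightarrow> (((nat \<Rightarrow> real) \<Rightarrow> 'a) \<Rightarrow> bit) set" where
  "cohomology_unit X = cohomology_class 0 X (\<lambda>\<sigma>. if singular_simplex 0 X \<sigma> then 1 else 0)"

text \<open>Isomorphism of graded algebras, given degree by degree. Additive maps between vector spaces
  over the two-element field are automatically linear.\<close>

definition cohomology_algebra_iso ::
  "'a topology \<Rightarrow> 'b topology
     \<Rightarrow> (nat \<Rightarrow> (((nat \<Rightarrow> real) \<Rightarrow> 'a) \<Rightarrow> bit) set \<Rightarrow> (((nat \<Rightarrow> real) \<Rightarrow> 'b) \<Rightarrow> bit) set) \<Rightarrow> bool" where
  "cohomology_algebra_iso X Y \<Phi> \<longleftrightarrow>
     (\<forall>p. \<Phi> p \<in> iso (cohomology_group p X) (cohomology_group p Y)) \<and>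
     (\<forall>p q. \<forall>A \<in> carrier (cohomology_group p X). \<forall>B \<in> carrier (cohomology_group q X).
        \<Phi> (p + q) (cup_product p q X A B) = cup_product p q Y (\<Phi> p A) (\<Phi> q B)) \<and>
     \<Phi> 0 (cohomology_unit X) = cohomology_unit Y"

definition same_mod2_cohomology :: "'a topology \<Rightarrow> 'b topology \<Rightarrow> bool"  (infix \<open>\<simeq>\<^sub>2\<close> 50) where
  "X \<simeq>\<^sub>2 Y \<longleftrightarrow> (\<exists>\<Phi>. cohomology_algebra_iso X Y \<Phi>)"


section \<open>Complex Milnor manifolds\<close>

definition quotient_topology :: "'a topology \<Rightarrow> ('a \<Rightarrow> 'b) \<Rightarrow> 'b topology" where
  "quotient_topology X q =
     topology (\<lambda>U. U \<subseteq> q ` topspace X \<and> openin X {x \<in> topspace X. q x \<in> U})"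

lemma openin_quotient_topology:
  "openin (quotient_topology X q) U \<longleftrightarrow>
     U \<subseteq> q ` topspace X \<and> openin X {x \<in> topspace X. q x \<in> U}"
proof -
  have "istopology (\<lambda>U. U \<subseteq> q ` topspace X \<and> openin X {x \<in> topspace X. q x \<in> U})"
    unfolding istopology_def
  proof (intro conjI allI impI; (elim conjE)?)
    fix S T
    assume "openin X {x \<in> topspace X. q x \<in> S}" "openin X {x \<in> topspace X. q x \<in> T}"
    then have "openin X ({x \<in> topspace X. q x \<in> S} \<inter> {x \<in> topspace X. q x \<in> T})"
      by (rule openin_Int)
    also have "{x \<in> topspace X. q x \<in> S} \<inter> {x \<in> topspace X. q x \<in> T} =
        {x \<in> topspace X. q x \<in> S \<inter> T}"
      by blast
    finally show "openin X {x \<in> topspace X. q x \<in> S \<inter> T}" .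
  next
    fix \<K>
    assume *: "\<forall>K\<in>\<K>. K \<subseteq> q ` topspace X \<and> openin X {x \<in> topspace X. q x \<in> K}"
    then show "\<Union>\<K> \<subseteq> q ` topspace X" by blast
    have "openin X (\<Union>K\<in>\<K>. {x \<in> topspace X. q x \<in> K})"
      using * by blast
    also have "(\<Union>K\<in>\<K>. {x \<in> topspace X. q x \<in> K}) = {x \<in> topspace X. q x \<in> \<Union>\<K>}"
      by blast
    finally show "openin X {x \<in> topspace X. q x \<in> \<Union>\<K>}" .
  qed blast
  then show ?thesis
    by (simp add: quotient_topology_def topology_inverse')
qed

text \<open>Nonzero vectors of complex (n+1)-space are sequences supported on the indices 0 to n.
  The type of all sequences carries the product topology, which induces
  the usual topology on this finite-dimensional subspace.\<close>

definition nonzero_vectors :: "nat \<Rightarrow> (nat \<Rightarrow> complex) set" where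
  "nonzero_vectors n = {z. (\<forall>i>n. z i = 0) \<and> z \<noteq> (\<lambda>_. 0)}"

definition homogeneous :: "(nat \<Rightarrow> complex) \<Rightarrow> (nat \<Rightarrow> complex) set" where
  "homogeneous z = {(\<lambda>i. c * z i) | c. c \<noteq> 0}"

definition complex_projective_space :: "nat \<Rightarrow> (nat \<Rightarrow> complex) set topology" where
  "complex_projective_space n = quotient_topology (top_of_set (nonzero_vectors n)) homogeneous"

definition complex_milnor_manifold ::
  "nat \<Rightarrow> nat \<Rightarrow> ((nat \<Rightarrow> complex) set \<times> (nat \<Rightarrow> complex) set) topology" where
  "complex_milnor_manifold r s =
     subtopology (prod_topology (complex_projective_space r) (complex_projective_space s))
       {(homogeneous z, homogeneous w) | z w.
          z \<in> nonzero_vectors r \<and> w \<in> nonzero_vectors s \<and> (\<Sum>i\<le>s. z i * cnj (w i)) = 0}"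


section \<open>Group actions on spaces and the Schwarz genus\<close>

text \<open>Groups carry the discrete topology. The library's group actions are by maps that are
  undefined outside the underlying set.\<close>

definition continuous_action :: "('g, 'm) monoid_scheme \<Rightarrow> 'a topology \<Rightarrow> ('g \<Rightarrow> 'a \<Rightarrow> 'a) \<Rightarrow> bool" where
  "continuous_action G X \<phi> \<longleftrightarrow>
     group_action G (topspace X) \<phi> \<and> (\<forall>g\<in>carrier G. continuous_map X X (\<phi> g))"

definition free_continuous_action ::
  "('g, 'm) monoid_scheme \<Rightarrow> 'a topology \<Rightarrow> ('g \<Rightarrow> 'a \<Rightarrow> 'a) \<Rightarrow> bool" where
  "free_continuous_action G X \<phi> \<longleftrightarrow>
     continuous_action G X \<phi> \<and>
     (\<forall>g\<in>carrier G. \<forall>x\<in>topspace X. \<phi> g x = x \<longrightarrow> g = \<one>\<^bsub>G\<^esub>)"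

definition equivariant_map ::
  "('g, 'm) monoid_scheme \<Rightarrow> 'a topology \<Rightarrow> ('g \<Rightarrow> 'a \<Rightarrow> 'a) \<Rightarrow> 'b topology \<Rightarrow> ('g \<Rightarrow> 'b \<Rightarrow> 'b)
     \<Rightarrow> ('a \<Rightarrow> 'b) \<Rightarrow> bool" where
  "equivariant_map G X \<phi> Y \<psi> f \<longleftrightarrow>
     continuous_map X Y f \<and> (\<forall>g\<in>carrier G. \<forall>x\<in>topspace X. f (\<phi> g x) = \<psi> g (f x))"

text \<open>The n-fold join of a finite group G, regarded as a 0-dimensional simplicial complex:
  the geometric realisation of the complex whose vertices are the pairs (i,g) with i < n and
  g in G, and whose simplices are the sets containing at most one vertex (i,g) for each i.
  Points are given by barycentric coordinates; as the complex is finite, its topology is the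
  subspace topology of the product topology.\<close>

definition join_power :: "nat \<Rightarrow> ('g, 'm) monoid_scheme \<Rightarrow> (nat \<times> 'g \<Rightarrow> real) topology" where
  "join_power n G = subtopology (powertop_real UNIV)
     {t. (\<forall>v. 0 \<le> t v) \<and> (\<forall>v. v \<notin> {..<n} \<times> carrier G \<longrightarrow> t v = 0) \<and>
         (\<Sum>v\<in>{..<n} \<times> carrier G. t v) = 1 \<and>
         (\<forall>i g h. t (i, g) \<noteq> 0 \<and> t (i, h) \<noteq> 0 \<longrightarrow> g = h)}"

text \<open>The element g moves the vertex (i,h) to (i,gh), for all i simultaneously.\<close>

definition join_power_action ::
  "nat \<Rightarrow> ('g, 'm) monoid_scheme \<Rightarrow> 'g \<Rightarrow> (nat \<times> 'g \<Rightarrow> real) \<Rightarrow> (nat \<times> 'g \<Rightarrow> real)" where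
  "join_power_action n G g =
     (\<lambda>t\<in>topspace (join_power n G).
        \<lambda>(i, h). if h \<in> carrier G then t (i, inv\<^bsub>G\<^esub> g \<otimes>\<^bsub>G\<^esub> h) else 0)"

text \<open>The genus is infinite if there is no equivariant map into any of the joins.\<close>

definition schwarz_genus_free ::
  "'a topology \<Rightarrow> ('g, 'm) monoid_scheme \<Rightarrow> ('g \<Rightarrow> 'a \<Rightarrow> 'a) \<Rightarrow> enat" where
  "schwarz_genus_free X G \<phi> =
     Inf {enat n | n. \<exists>f. equivariant_map G X \<phi> (join_power n G) (join_power_action n G) f}"

abbreviation Z2_group :: "int monoid" where
  "Z2_group \<equiv> integer_mod_group 2"

abbreviation circle :: "complex topology" where
  "circle \<equiv> top_of_set (sphere 0 1)"

definition antipodal_action :: "int \<Rightarrow> complex \<Rightarrow> complex" where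
  "antipodal_action g = (\<lambda>v\<in>sphere 0 1. if g = 0 then v else - v)"

end

theory Submission
  imports Defs
begin

text \<open>The Milnor manifold is covered by the open sets where z j and w k do not vanish, for j and k
  distinct. Each is homeomorphic to a complex affine space, hence contractible; all contain a common
  point; and any two meet in the complement of a hypersurface, which is path-connected because a
  complex line meets the hypersurface in finitely many points. Hence the manifold is path-connected
  and every mod 2 cocycle of degree 1 on it is a coboundary, and both properties pass to X.

  Both an equivariant map to the circle and one to the n-fold join with n at most 2 yield a
  nonvanishing complex function f on X with f(Tx) = -f(x). The sign change of a continuous square
  root of f along paths is a 1-cocycle; since it is a coboundary, f has a square root h on X
  that is continuous along every path. Follow h along a path from x to Tx and along
  the image of that path under T, from Tx to x. On the latter h equals, up to a constant sign, i times
  the values on the former, so that h(x) = (\<plusminus>i)(\<plusminus>i)h(x) = -h(x) with equal signs, although h(x) is not 0.\<close>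

section \<open>Mod 2 cochains in low degrees\<close>

declare add_bit_eq_xor [simp del] mult_bit_eq_and [simp del]

lemma bit_add_self [simp]: "(a::bit) + a = 0"
  by (cases a) simp_all

lemma bit_add_eq_0_iff: "(a::bit) + b = 0 \<longleftrightarrow> a = b"
  by (cases a; cases b) simp_all

text \<open>The Kronecker pairing. Chains keep integer coefficients and \<open>of_int\<close>
  reduces them mod 2, so that integral homology and subdivision can be applied to mod 2
  cochains.\<close>

definition chain_eval :: "('s \<Rightarrow> bit) \<Rightarrow> ('s \<Rightarrow>\<^sub>0 int) \<Rightarrow> bit" where
  "chain_eval c x = (\<Sum>\<sigma>\<in>Poly_Mapping.keys x. of_int (Poly_Mapping.lookup x \<sigma>) * c \<sigma>)"

lemma chain_eval_superset:
  assumes "finite A" "Poly_Mapping.keys x \<subseteq> A"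
  shows "chain_eval c x = (\<Sum>\<sigma>\<in>A. of_int (Poly_Mapping.lookup x \<sigma>) * c \<sigma>)"
  unfolding chain_eval_def
  by (rule sum.mono_neutral_left) (use assms in \<open>auto simp: in_keys_iff\<close>)

lemma chain_eval_0 [simp]: "chain_eval c 0 = 0"
  by (simp add: chain_eval_def)

lemma chain_eval_of [simp]: "chain_eval c (frag_of \<sigma>) = c \<sigma>"
  by (simp add: chain_eval_def)

lemma chain_eval_add: "chain_eval c (x + y) = chain_eval c x + chain_eval c y"
proof -
  let ?A = "Poly_Mapping.keys x \<union> Poly_Mapping.keys y"
  have "Poly_Mapping.keys (x + y) \<subseteq> ?A" by (rule keys_add)
  then show ?thesis
    by (simp add: chain_eval_superset[of ?A] lookup_add distrib_right sum.distrib)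
qed

lemma chain_eval_cmul: "chain_eval c (frag_cmul k x) = of_int k * chain_eval c x"
proof -
  have "Poly_Mapping.keys (frag_cmul k x) \<subseteq> Poly_Mapping.keys x"
    by (auto simp: in_keys_iff)
  then show ?thesis
    by (simp add: chain_eval_superset[of "Poly_Mapping.keys x"] sum_distrib_left mult.assoc)
qed

lemma chain_eval_minus [simp]: "chain_eval c (- x) = chain_eval c x"
  using chain_eval_cmul[of c "-1" x] by simp

lemma chain_eval_diff: "chain_eval c (x - y) = chain_eval c x + chain_eval c y"
  using chain_eval_add[of c x "- y"] by simp

lemma chain_eval_sum: "chain_eval c (sum f I) = (\<Sum>i\<in>I. chain_eval c (f i))"
  by (induction I rule: infinite_finite_induct) (simp_all add: chain_eval_add)

text \<open>Boundary and coboundary are adjoint. By linearity only a single simplex has to be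
  checked, and there the alternating signs of the boundary become 1 mod 2.\<close>

lemma chain_eval_boundary:
  assumes "singular_chain (Suc p) X x"
  shows "chain_eval c (chain_boundary (Suc p) x) = chain_eval (coboundary p X c) x"
  using assms[unfolded singular_chain_def]
proof (induction x rule: frag_induction)
  case (one \<sigma>)
  then show ?case
    by (simp add: chain_boundary_of chain_eval_sum chain_eval_cmul coboundary_def
        del: sum.atMost_Suc power_Suc)
qed (simp_all add: chain_boundary_diff chain_eval_diff)

lemma cocycle_boundary_eq_0:
  assumes "c \<in> cocycles p X" "singular_chain (Suc p) X x"
  shows "chain_eval c (chain_boundary (Suc p) x) = 0"
  using assms by (simp add: chain_eval_boundary cocycles_def) (simp add: chain_eval_def)

text \<open>In positive degree reduced and ordinary homology coincide, so contractibility leaves a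
  single homology class, that of the boundaries.\<close>

lemma contractible_cycle_is_boundary:
  assumes "contractible_space X" "p \<noteq> 0" "singular_relcycle p X {} z"
  shows "singular_relboundary p X {} z"
proof -
  have "trivial_group (homology_group (int p) X)"
    using trivial_reduced_homology_group_contractible_space[OF assms(1), of "int p"] assms(2)
    by (simp add: un_reduced_homology_group)
  then have "carrier (homology_group (int p) X) = {singular_relboundary_set p X {}}"
    by (simp add: trivial_group_def)
  moreover have "homologous_rel_set p X {} z \<in> carrier (homology_group (int p) X)"
    unfolding carrier_relative_homology_group using assms(3) by blast
  ultimately have "homologous_rel_set p X {} z = singular_relboundary_set p X {}"
    by (simp only: singleton_iff)
  then show ?thesis
    by (simp only: homologous_rel_set_eq_relboundary)
qed

section \<open>Points and paths as singular simplices\<close>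

definition vertex :: "nat \<Rightarrow> nat \<Rightarrow> real" where
  "vertex i = (\<lambda>j. if j = i then 1 else 0)"

lemma vertex_in_standard_simplex [simp]: "vertex i \<in> standard_simplex p \<longleftrightarrow> i \<le> p"
  by (simp add: vertex_def)

lemma simplical_face_vertex: "simplical_face k (vertex i) = vertex (if i < k then i else Suc i)"
  by (auto simp: simplical_face_def vertex_def fun_eq_iff)

lemma singular_face_vertex:
  "i \<le> p \<Longrightarrow> singular_face (Suc p) k \<sigma> (vertex i) = \<sigma> (vertex (if i < k then i else Suc i))"
  by (simp add: singular_face_def simplical_face_vertex)

lemma singular_simplex_in_topspace:
  "singular_simplex p X \<sigma> \<Longrightarrow> x \<in> standard_simplex p \<Longrightarrow> \<sigma> x \<in> topspace X"
  by (auto simp: singular_simplex_def continuous_map_def)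

text \<open>Singular simplices are extensional and the standard 0-simplex is a single point.\<close>

lemma singular_0_simplex_eqI:
  assumes "singular_simplex 0 X \<sigma>" "singular_simplex 0 X \<tau>" "\<sigma> (vertex 0) = \<tau> (vertex 0)"
  shows "\<sigma> = \<tau>"
  using assms by (intro extensionalityI[of _ "standard_simplex 0"])
    (auto simp: singular_simplex_def standard_simplex_0 vertex_def)

lemma singular_simplex_const:
  "x \<in> topspace X \<Longrightarrow> singular_simplex p X (\<lambda>_\<in>standard_simplex p. x)"
  unfolding singular_simplex_def
  by (auto intro: continuous_map_eq[of _ _ "\<lambda>_. x"])

lemma path_simplex_exists:
  assumes "path_component_of X x y"
  shows "\<exists>\<sigma>. singular_simplex 1 X \<sigma> \<and> \<sigma> (vertex 0) = x \<and> \<sigma> (vertex 1) = y"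
proof -
  obtain g where g: "pathin X g" "g 0 = x" "g 1 = y"
    using assms by (auto simp: path_component_of_def)
  \<comment> \<open>The coordinate \<open>t 1\<close> identifies the standard 1-simplex with the
    unit interval, with vertex 0 at 0 and vertex 1 at 1.\<close>
  let ?\<sigma> = "restrict (g \<circ> (\<lambda>t. t 1)) (standard_simplex 1)"
  have "continuous_map (subtopology (powertop_real UNIV) (standard_simplex 1))
          euclideanreal (\<lambda>t. t 1)"
    by (metis (mono_tags) UNIV_I continuous_map_from_subtopology continuous_map_product_projection)
  then have "continuous_map (subtopology (powertop_real UNIV) (standard_simplex 1))
          (top_of_set {0..1}) (\<lambda>t. t 1)"
    by (auto simp: continuous_map_in_subtopology standard_simplex_def)
  then have "continuous_map (subtopology (powertop_real UNIV) (standard_simplex 1)) X (g \<circ> (\<lambda>t. t 1))"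
    using g(1) unfolding pathin_def by (rule continuous_map_compose)
  then have "singular_simplex 1 X ?\<sigma>"
    by (simp add: singular_simplex_def continuous_map_eq)
  moreover have "?\<sigma> (vertex 0) = x" "?\<sigma> (vertex 1) = y"
    using g(2,3) by (simp_all add: vertex_def[THEN fun_cong])
  ultimately show ?thesis by blast
qed

lemma path_component_of_1_simplex:
  assumes "singular_simplex 1 X \<sigma>"
  shows "path_component_of X (\<sigma> (vertex 0)) (\<sigma> (vertex 1))"
proof -
  have "path_connectedin X (\<sigma> ` standard_simplex 1)"
    using assms path_connectedin_standard_simplex[of 1] unfolding singular_simplex_def
    by (meson path_connectedin_continuous_map_image path_connectedin_subtopology subset_refl)
  then have "\<sigma> ` standard_simplex 1 \<subseteq> Collect (path_component_of X (\<sigma> (vertex 0)))"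
    by (rule path_component_of_maximal) simp
  moreover have "\<sigma> (vertex 1) \<in> \<sigma> ` standard_simplex 1"
    by (rule imageI) simp
  ultimately show ?thesis
    by blast
qed

text \<open>Face k omits vertex k, which leaves the vertex \<open>1 - k\<close>; both sides are
  compared at the only point of the 0-simplex.\<close>

lemma singular_face_1_simplex:
  assumes "singular_simplex 1 X \<sigma>" "k \<le> 1"
  shows "singular_face 1 k \<sigma> = (\<lambda>_\<in>standard_simplex 0. \<sigma> (vertex (1 - k)))"
proof (rule singular_0_simplex_eqI)
  show "singular_simplex 0 X (singular_face 1 k \<sigma>)"
    using singular_simplex_singular_face[OF assms(1) _ assms(2)] by simp
  show "singular_simplex 0 X (\<lambda>_\<in>standard_simplex 0. \<sigma> (vertex (1 - k)))"
    by (intro singular_simplex_const singular_simplex_in_topspace[OF assms(1)]) simp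
  show "singular_face 1 k \<sigma> (vertex 0) = (\<lambda>_\<in>standard_simplex 0. \<sigma> (vertex (1 - k))) (vertex 0)"
    using singular_face_vertex[of 0 0 k \<sigma>] assms(2) by (cases k) auto
qed

lemma chain_boundary_1_simplex:
  assumes "singular_simplex 1 X \<sigma>"
  shows "chain_boundary 1 (frag_of \<sigma>) =
    frag_of (\<lambda>_\<in>standard_simplex 0. \<sigma> (vertex 1)) - frag_of (\<lambda>_\<in>standard_simplex 0. \<sigma> (vertex 0))"
  using singular_face_1_simplex[OF assms, of 0] singular_face_1_simplex[OF assms, of 1]
  by (simp add: chain_boundary_of)

lemma coboundary_0_eq:
  assumes "singular_simplex 1 X \<sigma>"
  shows "coboundary 0 X b \<sigma> = b (\<lambda>_\<in>standard_simplex 0. \<sigma> (vertex 0)) + b (\<lambda>_\<in>standard_simplex 0. \<sigma> (vertex 1))"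
  using assms singular_face_1_simplex[OF assms, of 0] singular_face_1_simplex[OF assms, of 1]
  by (simp add: coboundary_def add.commute)

text \<open>A 0-cochain amounts to a function on points. Later arguments produce and use
  1-coboundaries through such potentials on points.\<close>

lemma coboundaries_1_iff:
  "c \<in> coboundaries 1 X \<longleftrightarrow> c \<in> cochains 1 X \<and>
     (\<exists>b. \<forall>\<sigma>. singular_simplex 1 X \<sigma> \<longrightarrow> c \<sigma> = b (\<sigma> (vertex 0)) + b (\<sigma> (vertex 1)))"
proof safe
  assume "c \<in> coboundaries 1 X"
  then obtain b where c: "c = coboundary 0 X b"
    by (auto simp: coboundaries_def)
  show "c \<in> cochains 1 X"
    by (simp add: c cochains_def coboundary_def)
  show "\<exists>b. \<forall>\<sigma>. singular_simplex 1 X \<sigma> \<longrightarrow> c \<sigma> = b (\<sigma> (vertex 0)) + b (\<sigma> (vertex 1))"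
    unfolding c by (rule exI[of _ "\<lambda>x. b (\<lambda>_\<in>standard_simplex 0. x)"]) (simp add: coboundary_0_eq)
next
  fix b assume c: "c \<in> cochains 1 X"
    and b: "\<forall>\<sigma>. singular_simplex 1 X \<sigma> \<longrightarrow> c \<sigma> = b (\<sigma> (vertex 0)) + b (\<sigma> (vertex 1))"
  \<comment> \<open>Cochains vanish outside the singular simplices, so the potential has to be cut
    off there.\<close>
  define b' where "b' = (\<lambda>\<tau>. if singular_simplex 0 X \<tau> then b (\<tau> (vertex 0)) else 0)"
  have "c \<sigma> = coboundary 0 X b' \<sigma>" for \<sigma>
  proof (cases "singular_simplex 1 X \<sigma>")
    case True
    then show ?thesis
      using b by (simp add: coboundary_0_eq b'_def singular_simplex_const singular_simplex_in_topspace)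
  next
    case False
    then show ?thesis
      using c by (simp add: cochains_def coboundary_def)
  qed
  moreover have "b' \<in> cochains 0 X"
    by (simp add: b'_def cochains_def)
  ultimately show "c \<in> coboundaries 1 X"
    unfolding coboundaries_def by (auto intro!: image_eqI[of _ _ b'])
qed

section \<open>Potentials of 1-cocycles\<close>

lemma triangle_is_cycle:
  assumes "singular_simplex 1 X \<rho>" "singular_simplex 1 X \<sigma>" "singular_simplex 1 X \<tau>"
    and "\<rho> (vertex 1) = \<sigma> (vertex 0)" "\<rho> (vertex 0) = \<tau> (vertex 0)" "\<sigma> (vertex 1) = \<tau> (vertex 1)"
  shows "singular_relcycle 1 X {} (frag_of \<rho> + frag_of \<sigma> - frag_of \<tau>)"
  using assms chain_boundary_1_simplex[OF assms(1)] chain_boundary_1_simplex[OF assms(2)]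
    chain_boundary_1_simplex[OF assms(3)]
  by (simp add: singular_cycle singular_chain_add singular_chain_diff singular_chain_of
      chain_boundary_add chain_boundary_diff)

text \<open>A cycle of positive degree in U bounds inside U, and a cocycle vanishes on every
  boundary.\<close>

lemma cocycle_on_contractible_subspace:
  assumes "c \<in> cocycles p X" "p \<noteq> 0" "contractible_space (subtopology X U)"
    and "singular_relcycle p (subtopology X U) {} z"
  shows "chain_eval c z = 0"
proof -
  obtain d where "singular_chain (Suc p) (subtopology X U) d" "chain_boundary (Suc p) d = z"
    using contractible_cycle_is_boundary[OF assms(3,2,4)] by (auto simp: singular_boundary)
  then show ?thesis
    using cocycle_boundary_eq_0[OF assms(1)] by (auto simp: singular_chain_subtopology)
qed

text \<open>The assumption is Stokes' formula on the single simplices of the chain, which extends by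
  linearity.\<close>

lemma chain_eval_potential_on_small_chain:
  assumes "\<And>\<sigma>. \<sigma> \<in> Poly_Mapping.keys z \<Longrightarrow> c \<sigma> = b (\<sigma> (vertex 0)) + b (\<sigma> (vertex 1))"
    and "singular_chain 1 X z"
  shows "chain_eval c z = chain_eval (\<lambda>\<tau>. b (\<tau> (vertex 0))) (chain_boundary 1 z)"
proof -
  have "Poly_Mapping.keys z \<subseteq> {\<sigma>. singular_simplex 1 X \<sigma> \<and> c \<sigma> = b (\<sigma> (vertex 0)) + b (\<sigma> (vertex 1))}"
    using assms by (auto simp: singular_chain_def)
  then show ?thesis
  proof (induction z rule: frag_induction)
    case (one \<sigma>)
    then have "chain_boundary 1 (frag_of \<sigma>) =
        frag_of (\<lambda>_\<in>standard_simplex 0. \<sigma> (vertex 1)) - frag_of (\<lambda>_\<in>standard_simplex 0. \<sigma> (vertex 0))"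
      by (intro chain_boundary_1_simplex[of X]) auto
    then show ?case
      using one by (simp add: chain_eval_diff add.commute)
  qed (simp_all add: chain_boundary_diff chain_eval_diff add_ac)
qed

text \<open>The potential b is the value of c on any path from the base point that stays in one member
  of the cover; path-connected intersections make it independent of the member. Subdivision
  carries the result from small simplices to all simplices.\<close>

lemma cocycle_potential_of_cover:
  assumes c: "c \<in> cocycles 1 X"
    and opn: "\<And>U. U \<in> \<U> \<Longrightarrow> openin X U"
    and cover: "topspace X \<subseteq> \<Union>\<U>"
    and contr: "\<And>U. U \<in> \<U> \<Longrightarrow> contractible_space (subtopology X U)"
    and inter: "\<And>U V. U \<in> \<U> \<Longrightarrow> V \<in> \<U> \<Longrightarrow> path_connected_space (subtopology X (U \<inter> V))"
    and base: "x0 \<in> topspace X" "\<And>U. U \<in> \<U> \<Longrightarrow> x0 \<in> U"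
  obtains b :: "'a \<Rightarrow> bit" where
    "\<And>\<sigma>. singular_simplex 1 X \<sigma> \<Longrightarrow> c \<sigma> = b (\<sigma> (vertex 0)) + b (\<sigma> (vertex 1))"
proof -
  \<comment> \<open>\<open>?S U x\<close> describes the paths in U from the base point to x.\<close>
  let ?S = "\<lambda>U x \<sigma>. singular_simplex 1 (subtopology X U) \<sigma> \<and> \<sigma> (vertex 0) = x0 \<and> \<sigma> (vertex 1) = x"
  have ex: "\<exists>\<sigma>. ?S (U \<inter> V) x \<sigma>" if "U \<in> \<U>" "V \<in> \<U>" "x \<in> topspace X" "x \<in> U \<inter> V" for U V x
  proof (rule path_simplex_exists)
    show "path_component_of (subtopology X (U \<inter> V)) x0 x"
      using inter[OF that(1,2)] that base unfolding path_connected_space_def path_component_of_def by auto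
  qed
  have triangle: "c \<rho> + c \<sigma> = c \<tau>"
    if "U \<in> \<U>" "singular_simplex 1 (subtopology X U) \<rho>" "singular_simplex 1 (subtopology X U) \<sigma>"
      "singular_simplex 1 (subtopology X U) \<tau>"
      "\<rho> (vertex 1) = \<sigma> (vertex 0)" "\<rho> (vertex 0) = \<tau> (vertex 0)" "\<sigma> (vertex 1) = \<tau> (vertex 1)"
    for U \<rho> \<sigma> \<tau>
    using cocycle_on_contractible_subspace[OF c _ contr[OF that(1)] triangle_is_cycle[OF that(2-7)]]
    by (simp add: chain_eval_add chain_eval_diff bit_add_eq_0_iff)
  have bigon: "c \<sigma> = c \<tau>" if "U \<in> \<U>" "?S U x \<sigma>" "?S U x \<tau>" for U x \<sigma> \<tau>
  proof -
    \<comment> \<open>The constant path at the base point is the first side of two triangles with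
      the same second side, so their third sides take the same value.\<close>
    have k: "singular_simplex 1 (subtopology X U) (\<lambda>_\<in>standard_simplex 1. x0)"
      using base that(1) by (intro singular_simplex_const) auto
    have "c (\<lambda>_\<in>standard_simplex 1. x0) + c \<sigma> = c \<sigma>"
      "c (\<lambda>_\<in>standard_simplex 1. x0) + c \<sigma> = c \<tau>"
      by (rule triangle[OF that(1) k]; use that in simp)+
    then show ?thesis by simp
  qed
  \<comment> \<open>The path is chosen in any member of the cover that contains one.\<close>
  define b where "b = (\<lambda>x. c (SOME \<sigma>. \<exists>U\<in>\<U>. ?S U x \<sigma>))"
  have b: "b x = c \<sigma>" if U: "U \<in> \<U>" "?S U x \<sigma>" for U x \<sigma>
  proof -
    let ?\<tau> = "SOME \<sigma>. \<exists>U\<in>\<U>. ?S U x \<sigma>"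
    have "\<exists>\<sigma>. \<exists>U\<in>\<U>. ?S U x \<sigma>" using that by blast
    then have "\<exists>U\<in>\<U>. ?S U x ?\<tau>" by (rule someI_ex)
    then obtain V where V: "V \<in> \<U>" "?S V x ?\<tau>" by blast
    have "x \<in> topspace (subtopology X U)" "x \<in> topspace (subtopology X V)"
      using that(2) V(2) singular_simplex_in_topspace[where x = "vertex 1"] by fastforce+
    \<comment> \<open>A path in the intersection lies in both members and links the given path in U
      to the chosen one in V.\<close>
    then obtain \<rho> where "?S (U \<inter> V) x \<rho>"
      using ex[OF U(1) V(1), of x] by auto
    then have "?S U x \<rho>" "?S V x \<rho>"
      by (auto intro: singular_simplex_mono)
    then show ?thesis
      using bigon[OF that(1), of \<rho> x \<sigma>] bigon[OF V(1), of \<rho> x ?\<tau>] that V by (simp add: b_def)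
  qed
  have small: "c \<sigma> = b (\<sigma> (vertex 0)) + b (\<sigma> (vertex 1))"
    if U: "U \<in> \<U>" and \<sigma>: "singular_simplex 1 (subtopology X U) \<sigma>" for U \<sigma>
  proof -
    have "\<sigma> (vertex i) \<in> topspace (subtopology X U)" if "i \<le> 1" for i
      using singular_simplex_in_topspace[OF \<sigma>] that by simp
    then have "\<exists>\<rho>. ?S U (\<sigma> (vertex i)) \<rho>" if "i \<le> 1" for i
      using ex[OF U U, of "\<sigma> (vertex i)"] that by simp
    then obtain \<rho> \<tau> where *: "?S U (\<sigma> (vertex 0)) \<rho>" "?S U (\<sigma> (vertex 1)) \<tau>"
      by (metis le_refl zero_le_one)
    then have "c \<rho> + c \<sigma> = c \<tau>"
      by (intro triangle[OF U _ \<sigma>]) simp_all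
    then show ?thesis
      using b[OF U *(1)] b[OF U *(2)] by (cases "c \<rho>"; cases "c \<sigma>") auto
  qed
  show ?thesis
  proof
    fix \<sigma> assume \<sigma>: "singular_simplex 1 X \<sigma>"
    let ?\<beta> = "\<lambda>\<tau>. b (\<tau> (vertex 0))"
    let ?z = "frag_of \<sigma>"
    have z: "singular_chain 1 X ?z" using \<sigma> by (simp add: singular_chain_of)
    obtain n where n: "\<And>m f. n \<le> m \<Longrightarrow> f \<in> Poly_Mapping.keys ((singular_subdivision 1 ^^ m) ?z)
        \<Longrightarrow> \<exists>V\<in>\<U>. f \<in> standard_simplex 1 \<rightarrow> V"
      using sufficient_iterated_singular_subdivision_exists[OF opn cover z] by blast
    \<comment> \<open>A chain homotopy from the identity to the n-fold subdivision. It does not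
      depend on the space, so it keeps chains inside every subspace that contains them.\<close>
    obtain h where h: "\<And>p c1 c2. h p (c1 - c2) = h p c1 - (h p c2 :: 'a chain)"
      "\<And>p X c. singular_chain p X c \<Longrightarrow> singular_chain (Suc p) X (h p c)"
      "\<And>p X c. singular_chain p X c \<Longrightarrow>
        chain_boundary (Suc p) (h p c) + h (p - Suc 0) (chain_boundary p c)
          = (singular_subdivision p ^^ n) c - c"
      by (rule chain_homotopic_iterated_singular_subdivision) blast
    \<comment> \<open>The endpoint correction: subdivision changes \<open>\<sigma>\<close> by a
      boundary, which the cocycle kills, and by w.\<close>
    define w where "w = h 0 (chain_boundary 1 ?z)"
    have sub: "(singular_subdivision 1 ^^ n) ?z = ?z + chain_boundary 2 (h 1 ?z) + w"
      using h(3)[OF z] by (simp add: w_def numeral_2_eq_2 algebra_simps)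
    have "singular_chain 0 X (chain_boundary 1 ?z)"
      using singular_chain_boundary[OF z] by simp
    then have "singular_chain 1 X w"
      using h(2)[of 0 X] by (simp add: w_def)
    \<comment> \<open>Applied to a single point, the homotopy stays in a member of the cover around
      that point. Hence w consists of small pieces, on which the potential is already known.\<close>
    have pt: "\<exists>U\<in>\<U>. singular_chain 1 (subtopology X U) (h 0 (frag_of (\<lambda>_\<in>standard_simplex 0. x)))"
      if x: "x \<in> topspace X" for x
    proof -
      obtain U where "U \<in> \<U>" "x \<in> U" using x cover by blast
      then have "singular_chain 0 (subtopology X U) (frag_of (\<lambda>_\<in>standard_simplex 0. x))"
        using x by (simp add: singular_chain_of singular_simplex_const)
      with h(2)[OF this] \<open>U \<in> \<U>\<close> show ?thesis by auto
    qed
    have eval_small: "chain_eval c y = chain_eval ?\<beta> (chain_boundary 1 y)"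
      if "U \<in> \<U>" "singular_chain 1 (subtopology X U) y" for U y
    proof (rule chain_eval_potential_on_small_chain)
      show "singular_chain 1 X y" using that by (simp add: singular_chain_subtopology)
      show "c \<sigma> = b (\<sigma> (vertex 0)) + b (\<sigma> (vertex 1))" if "\<sigma> \<in> Poly_Mapping.keys y" for \<sigma>
        using that \<open>singular_chain 1 (subtopology X U) y\<close>
        by (intro small[OF \<open>U \<in> \<U>\<close>]) (auto simp: singular_chain_def)
    qed
    let ?h = "\<lambda>i. h 0 (frag_of (\<lambda>_\<in>standard_simplex 0. \<sigma> (vertex i)))"
    have "chain_eval c (?h i) = chain_eval ?\<beta> (chain_boundary 1 (?h i))" if "i \<le> 1" for i
      using pt[of "\<sigma> (vertex i)"] singular_simplex_in_topspace[OF \<sigma>, of "vertex i"] that eval_small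
      by auto
    from this[of 0] this[of 1]
    have eval_w: "chain_eval c w = chain_eval ?\<beta> (chain_boundary 1 w)"
      unfolding w_def chain_boundary_1_simplex[OF \<sigma>] h(1) chain_eval_diff chain_boundary_diff
      by simp
    have schain: "singular_chain 1 X ((singular_subdivision 1 ^^ n) ?z)"
      unfolding sub using z \<open>singular_chain 1 X w\<close> h(2)[OF z]
      by (intro singular_chain_add singular_chain_boundary_alt) (simp_all add: numeral_2_eq_2 singular_chain_boundary_alt)
    have "chain_eval c ((singular_subdivision 1 ^^ n) ?z)
        = chain_eval ?\<beta> (chain_boundary 1 ((singular_subdivision 1 ^^ n) ?z))"
    proof (rule chain_eval_potential_on_small_chain[OF _ schain])
      fix f assume f: "f \<in> Poly_Mapping.keys ((singular_subdivision 1 ^^ n) ?z)"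
      then have "singular_simplex 1 X f" using schain by (auto simp: singular_chain_def)
      moreover obtain V where "V \<in> \<U>" "f \<in> standard_simplex 1 \<rightarrow> V" using n[OF le_refl f] by blast
      ultimately show "c f = b (f (vertex 0)) + b (f (vertex 1))"
        by (intro small[of V]) (auto simp: singular_simplex_subtopology)
    qed
    moreover have "chain_eval c (chain_boundary 2 (h 1 ?z)) = 0"
      using cocycle_boundary_eq_0[OF c h(2)[OF z]] by (simp add: numeral_2_eq_2)
    moreover have "chain_boundary 1 (chain_boundary 2 (h 1 ?z)) = 0"
      using chain_boundary_boundary_alt[OF h(2)[OF z, simplified]] by (simp add: numeral_2_eq_2)
    \<comment> \<open>Both sides of the formula on the subdivision contain the contribution of w,
      which therefore cancels.\<close>
    ultimately have "c \<sigma> + chain_eval c w = chain_eval ?\<beta> (chain_boundary 1 ?z) + chain_eval c w"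
      unfolding sub chain_eval_add chain_boundary_add eval_w by simp
    then have "c \<sigma> = chain_eval ?\<beta> (chain_boundary 1 ?z)" by simp
    then show "c \<sigma> = b (\<sigma> (vertex 0)) + b (\<sigma> (vertex 1))"
      unfolding chain_boundary_1_simplex[OF \<sigma>] by (simp add: chain_eval_diff add.commute)
  qed
qed

section \<open>The square root cocycle\<close>

text \<open>An affine parametrisation of the plane of the 2-simplex. It moves simplices from a
  function space into a normed space, where nonvanishing functions on contractible sets have
  continuous logarithms.\<close>

definition triangle_coords :: "real \<times> real \<Rightarrow> nat \<Rightarrow> real" where
  "triangle_coords = (\<lambda>(a, b) i. if i = 0 then 1 - a - b else if i = 1 then a else if i = 2 then b else 0)"

lemma triangle_coords_eq:
  assumes "x \<in> standard_simplex p" "p \<le> 2"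
  shows "triangle_coords (x 1, x 2) = x"
proof -
  have x: "x \<in> standard_simplex 2"
    using assms standard_simplex_mono by blast
  then have "x 0 + x 1 + x 2 = 1" "\<forall>i>2. x i = 0"
    by (auto simp: standard_simplex_def numeral_2_eq_2 algebra_simps)
  then show ?thesis
    by (auto simp: triangle_coords_def fun_eq_iff)
qed

lemma continuous_on_triangle_coords: "continuous_on S triangle_coords"
proof (rule continuous_on_coordinatewise_then_product)
  show "continuous_on S (\<lambda>x. triangle_coords x i)" for i
    unfolding triangle_coords_def case_prod_unfold
    by (cases "i = 0"; cases "i = 1"; cases "i = 2") (simp_all add: continuous_intros)
qed

text \<open>Over a convex, hence contractible, subset of the plane a nonvanishing function has a
  continuous logarithm, and halving it gives the root. Dimension 1 serves paths, dimension 2 the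
  cocycle condition.\<close>

lemma continuous_sqrt_on_standard_simplex:
  fixes u :: "(nat \<Rightarrow> real) \<Rightarrow> complex"
  assumes "p \<le> 2" and u: "continuous_on (standard_simplex p) u" "\<And>x. x \<in> standard_simplex p \<Longrightarrow> u x \<noteq> 0"
  obtains g where "continuous_on (standard_simplex p) g" "\<And>x. x \<in> standard_simplex p \<Longrightarrow> g x ^ 2 = u x"
proof -
  let ?T = "triangle_coords -` standard_simplex p"
  have "convex ?T"
  proof (rule convexI)
    fix x y :: "real \<times> real" and a b :: real
    assume *: "x \<in> ?T" "y \<in> ?T" "0 \<le> a" "0 \<le> b" "a + b = 1"
    have "triangle_coords (a *\<^sub>R x + b *\<^sub>R y) = (\<lambda>i. (1 - b) * triangle_coords x i + b * triangle_coords y i)"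
    proof
      fix i
      \<comment> \<open>The parametrisation is affine but not linear, so its zeroth coordinate
        depends on \<open>a + b = 1\<close>.\<close>
      have a: "a = 1 - b" using * by simp
      show "triangle_coords (a *\<^sub>R x + b *\<^sub>R y) i = (1 - b) * triangle_coords x i + b * triangle_coords y i"
        unfolding a by (cases x; cases y) (simp add: triangle_coords_def algebra_simps)
    qed
    then show "a *\<^sub>R x + b *\<^sub>R y \<in> ?T"
      using * convex_standard_simplex by auto
  qed
  then have "contractible ?T" by (rule convex_imp_contractible)
  moreover have "continuous_on ?T (u \<circ> triangle_coords)"
    by (intro continuous_on_compose continuous_on_triangle_coords continuous_on_subset[OF u(1)]) auto
  ultimately obtain l where l: "continuous_on ?T l" "\<And>x. x \<in> ?T \<Longrightarrow> u (triangle_coords x) = exp (l x)"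
    using continuous_logarithm_on_contractible[of ?T "u \<circ> triangle_coords"] u(2) by auto
  show ?thesis
  proof
    let ?e = "\<lambda>x::nat \<Rightarrow> real. (x 1, x 2)"
    have e: "triangle_coords (?e x) = x" if "x \<in> standard_simplex p" for x
      using triangle_coords_eq[OF that assms(1)] .
    have "continuous_on (standard_simplex p) (l \<circ> ?e)"
    proof (intro continuous_on_compose continuous_on_subset[OF l(1)])
      show "continuous_on (standard_simplex p) ?e"
        by (intro continuous_intros continuous_on_subset[OF continuous_on_product_coordinates]) auto
    qed (auto simp: e[simplified])
    then show "continuous_on (standard_simplex p) (\<lambda>x. exp (l (?e x) / 2))"
      unfolding o_def by (intro continuous_intros) auto
    fix x assume x: "x \<in> standard_simplex p"
    then have "u x = exp (l (?e x))"
      using l(2)[of "?e x"] by (simp add: e[simplified])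
    then show "exp (l (?e x) / 2) ^ 2 = u x"
      by (simp flip: exp_double)
  qed
qed

text \<open>The quotient of the two roots is continuous with values in {1, -1}, hence constant on a
  connected set; the conclusion is this constancy with denominators cleared.\<close>

lemma continuous_sqrt_unique_up_to_sign:
  fixes g h :: "'a::topological_space \<Rightarrow> complex"
  assumes "connected S" "continuous_on S g" "continuous_on S h"
    and "\<And>x. x \<in> S \<Longrightarrow> g x ^ 2 = h x ^ 2" "\<And>x. x \<in> S \<Longrightarrow> h x \<noteq> 0"
    and "x \<in> S" "y \<in> S"
  shows "g x * h y = g y * h x"
proof -
  let ?k = "\<lambda>x. g x / h x"
  have "?k z = 1 \<or> ?k z = - 1" if "z \<in> S" for z
    using assms(4,5)[OF that] by (auto simp: power2_eq_iff)
  then have "?k ` S \<subseteq> {1, -1}"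
    by blast
  then have "finite (?k ` S)"
    by (rule finite_subset) simp
  moreover have "connected (?k ` S)"
    using assms by (intro connected_continuous_image continuous_intros) auto
  ultimately obtain a where "?k ` S = {a}"
    using assms(6) by (auto simp: connected_finite_iff_sing)
  then have "?k x = a" "?k y = a"
    using assms(6,7) by auto
  then have "?k x = ?k y"
    by simp
  then show ?thesis
    using assms(5-7) by (simp add: field_simps)
qed

section \<open>Signs of square roots along paths\<close>

lemma connected_standard_simplex: "connected (standard_simplex p)"
  using connectedin_standard_simplex[of p] by (simp add: euclidean_product_topology)

lemma continuous_on_singular_simplex:
  assumes "singular_simplex p X \<sigma>" "continuous_map X euclidean f"
  shows "continuous_on (standard_simplex p) (\<lambda>t. f (\<sigma> t))"
proof -
  have "continuous_map (top_of_set (standard_simplex p)) X \<sigma>"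
    using assms(1) by (simp add: singular_simplex_def euclidean_product_topology)
  from continuous_map_compose[OF this assms(2)] show ?thesis
    by (simp add: o_def)
qed

text \<open>The isomorphism from the additive group of \<open>bit\<close> onto the signs 1 and -1,
  which turns choices of square roots into cochain values.\<close>

definition bit_sign :: "bit \<Rightarrow> complex" where
  "bit_sign b = (if b = 0 then 1 else - 1)"

lemma bit_sign_simps [simp]:
  "bit_sign 0 = 1" "bit_sign 1 = - 1" "bit_sign b \<noteq> 0" "bit_sign b ^ 2 = 1" "bit_sign b * bit_sign b = 1"
  by (simp_all add: bit_sign_def)

lemma bit_sign_inject: "bit_sign a = bit_sign b \<longleftrightarrow> a = b"
  by (cases a; cases b) simp_all

lemma square_eq_iff_bit_sign: "g ^ 2 = h ^ 2 \<longleftrightarrow> (\<exists>b. g = bit_sign b * h)"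
proof
  assume "g ^ 2 = h ^ 2"
  then have "g = bit_sign 0 * h \<or> g = bit_sign 1 * h"
    by (simp add: power2_eq_iff)
  then show "\<exists>b. g = bit_sign b * h" by blast
qed (auto simp: power_mult_distrib)

text \<open>A value of 1 says that a continuous square root of f along the path passes from one sign
  of the set-theoretic square root csqrt f to the other.\<close>

definition sign_change :: "'a topology \<Rightarrow> ('a \<Rightarrow> complex) \<Rightarrow> ((nat \<Rightarrow> real) \<Rightarrow> 'a) \<Rightarrow> bit" where
  "sign_change X f \<sigma> =
     (if singular_simplex 1 X \<sigma> \<and>
         \<not> (\<exists>g. continuous_on (standard_simplex 1) g \<and> (\<forall>t\<in>standard_simplex 1. g t ^ 2 = f (\<sigma> t)) \<and>
              g (vertex 0) = csqrt (f (\<sigma> (vertex 0))) \<and> g (vertex 1) = csqrt (f (\<sigma> (vertex 1))))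
      then 1 else 0)"

text \<open>If the end signs of g relative to \<open>csqrt\<close> agree, g or its negative is the
  root asked for in \<open>sign_change\<close>; if they differ, uniqueness up to sign excludes such
  a root. Hence any continuous root may be used for the computation.\<close>

lemma sign_change_eq:
  assumes \<sigma>: "singular_simplex 1 X \<sigma>"
    and f: "\<And>x. x \<in> topspace X \<Longrightarrow> f x \<noteq> 0"
    and g: "continuous_on (standard_simplex 1) g" "\<And>t. t \<in> standard_simplex 1 \<Longrightarrow> g t ^ 2 = f (\<sigma> t)"
    and a: "g (vertex 0) = bit_sign a * csqrt (f (\<sigma> (vertex 0)))"
    and b: "g (vertex 1) = bit_sign b * csqrt (f (\<sigma> (vertex 1)))"
  shows "sign_change X f \<sigma> = a + b"
proof (cases "a = b")
  case True
  let ?h = "\<lambda>t. bit_sign a * g t"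
  have "continuous_on (standard_simplex 1) ?h"
    by (intro continuous_intros g)
  moreover have "\<forall>t\<in>standard_simplex 1. ?h t ^ 2 = f (\<sigma> t)"
    using g(2) by (simp add: power_mult_distrib)
  moreover have "?h (vertex 0) = csqrt (f (\<sigma> (vertex 0)))" "?h (vertex 1) = csqrt (f (\<sigma> (vertex 1)))"
    using a b True by (simp_all flip: mult.assoc)
  ultimately show ?thesis
    using True unfolding sign_change_def by auto
next
  case False
  have "\<not> (continuous_on (standard_simplex 1) h \<and> (\<forall>t\<in>standard_simplex 1. h t ^ 2 = f (\<sigma> t)) \<and>
              h (vertex 0) = csqrt (f (\<sigma> (vertex 0))) \<and> h (vertex 1) = csqrt (f (\<sigma> (vertex 1))))" for h
  proof
    assume h: "continuous_on (standard_simplex 1) h \<and> (\<forall>t\<in>standard_simplex 1. h t ^ 2 = f (\<sigma> t)) \<and>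
              h (vertex 0) = csqrt (f (\<sigma> (vertex 0))) \<and> h (vertex 1) = csqrt (f (\<sigma> (vertex 1)))"
    have nz: "f (\<sigma> t) \<noteq> 0" if "t \<in> standard_simplex 1" for t
      using f singular_simplex_in_topspace[OF \<sigma> that] .
    have "g (vertex 0) * h (vertex 1) = g (vertex 1) * h (vertex 0)"
    proof (rule continuous_sqrt_unique_up_to_sign[OF connected_standard_simplex[of 1] g(1)])
      show "h t \<noteq> 0" if "t \<in> standard_simplex 1" for t
        using h nz[OF that] that by (metis power_zero_numeral)
    qed (use h g(2) in auto)
    then have "bit_sign a = bit_sign b"
      using h a b nz[of "vertex 0"] nz[of "vertex 1"] by simp
    then show False
      using False by (simp add: bit_sign_inject)
  qed
  then have "sign_change X f \<sigma> = 1"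
    using \<sigma> unfolding sign_change_def by auto
  then show ?thesis
    using False by (cases a; cases b) auto
qed

lemma continuous_on_simplical_face: "continuous_on S (simplical_face k :: (nat \<Rightarrow> real) \<Rightarrow> _)"
proof (rule continuous_on_coordinatewise_then_product)
  show "continuous_on S (\<lambda>x. simplical_face k x i :: real)" for i
    unfolding simplical_face_def
    by (cases "i < k"; cases "i = k")
      (simp_all add: continuous_on_subset[OF continuous_on_product_coordinates])
qed

text \<open>One continuous root over the whole triangle restricts to the three sides. Each vertex
  sign then occurs in exactly two sides, so the sum vanishes mod 2.\<close>

lemma sign_change_cocycle:
  assumes f: "continuous_map X euclidean f" "\<And>x. x \<in> topspace X \<Longrightarrow> f x \<noteq> 0"
  shows "sign_change X f \<in> cocycles 1 X"
proof -
  have "coboundary 1 X (sign_change X f) \<sigma> = 0" for \<sigma>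
  proof (cases "singular_simplex 2 X \<sigma>")
    case True
    obtain G where G: "continuous_on (standard_simplex 2) G"
      "\<And>t. t \<in> standard_simplex 2 \<Longrightarrow> G t ^ 2 = f (\<sigma> t)"
      using continuous_sqrt_on_standard_simplex[of 2 "\<lambda>t. f (\<sigma> t)"]
        continuous_on_singular_simplex[OF True f(1)] f(2) singular_simplex_in_topspace[OF True] by auto
    have "\<forall>i\<in>{..2}. \<exists>b. G (vertex i) = bit_sign b * csqrt (f (\<sigma> (vertex i)))"
      using G(2) by (simp flip: square_eq_iff_bit_sign)
    then obtain e where e: "\<And>i. i \<le> 2 \<Longrightarrow> G (vertex i) = bit_sign (e i) * csqrt (f (\<sigma> (vertex i)))"
      by (metis atMost_iff)
    \<comment> \<open>The two indices are the vertices that remain, in order, when vertex k is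
      omitted.\<close>
    have face: "sign_change X f (singular_face 2 k \<sigma>) = e (if 0 < k then 0 else 1) + e (if 1 < k then 1 else 2)"
      if k: "k \<le> 2" for k
    proof (rule sign_change_eq[OF _ f(2)])
      show "singular_simplex 1 X (singular_face 2 k \<sigma>)"
        using singular_simplex_singular_face[OF True _ k] by simp
      have in2: "simplical_face k t \<in> standard_simplex 2" if "t \<in> standard_simplex 1" for t
        using simplical_face_in_standard_simplex[of 2 k t] k that by simp
      show "continuous_on (standard_simplex 1) (G \<circ> simplical_face k)"
        by (intro continuous_on_compose continuous_on_simplical_face continuous_on_subset[OF G(1)])
          (use in2 in auto)
      show "(G \<circ> simplical_face k) t ^ 2 = f (singular_face 2 k \<sigma> t)" if "t \<in> standard_simplex 1" for t
        using G(2)[OF in2[OF that]] that by (simp add: singular_face_def)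
      show "(G \<circ> simplical_face k) (vertex 0) =
          bit_sign (e (if 0 < k then 0 else 1)) * csqrt (f (singular_face 2 k \<sigma> (vertex 0)))"
        using singular_face_vertex[of 0 1 k \<sigma>] e[of 0] e[of 1]
        by (simp add: simplical_face_vertex numeral_2_eq_2)
      show "(G \<circ> simplical_face k) (vertex 1) =
          bit_sign (e (if 1 < k then 1 else 2)) * csqrt (f (singular_face 2 k \<sigma> (vertex 1)))"
        using singular_face_vertex[of 1 1 k \<sigma>] e[of 1] e[of 2]
        by (simp add: simplical_face_vertex numeral_2_eq_2)
    qed
    have "coboundary 1 X (sign_change X f) \<sigma> = (\<Sum>k\<le>2. sign_change X f (singular_face 2 k \<sigma>))"
      using True by (simp add: coboundary_def numeral_2_eq_2)
    also have "\<dots> = (\<Sum>k\<le>2::nat. e (if 0 < k then 0 else 1) + e (if 1 < k then 1 else 2))"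
      by (rule sum.cong) (simp_all add: face)
    also have "\<dots> = 0"
      by (simp add: numeral_2_eq_2 ac_simps)
    finally show ?thesis .
  qed (simp add: coboundary_def numeral_2_eq_2)
  then show ?thesis
    by (auto simp: cocycles_def cochains_def sign_change_def)
qed

section \<open>Odd functions and trivial first cohomology\<close>

lemma no_odd_nonvanishing_function:
  fixes f :: "'a \<Rightarrow> complex"
  assumes H1: "cocycles 1 X \<subseteq> coboundaries 1 X"
    and T: "continuous_map X X T" "\<And>x. x \<in> topspace X \<Longrightarrow> T (T x) = x"
    and f: "continuous_map X euclidean f" "\<And>x. x \<in> topspace X \<Longrightarrow> f x \<noteq> 0"
      "\<And>x. x \<in> topspace X \<Longrightarrow> f (T x) = - f x"
    and x: "path_component_of X x (T x)"
  shows False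
proof -
  have "sign_change X f \<in> coboundaries 1 X"
    using H1 sign_change_cocycle[OF f(1,2)] by blast
  then obtain b where b: "\<And>\<sigma>. singular_simplex 1 X \<sigma> \<Longrightarrow>
      sign_change X f \<sigma> = b (\<sigma> (vertex 0)) + b (\<sigma> (vertex 1))"
    unfolding coboundaries_1_iff by blast
  \<comment> \<open>Correcting \<open>csqrt\<close> by the potential makes the root consistent along
    paths, as \<open>along\<close> shows: a continuous root that starts at a value of h also ends at
    one.\<close>
  define h where "h = (\<lambda>x. bit_sign (b x) * csqrt (f x))"
  have h2: "h y ^ 2 = f y" for y
    by (simp add: h_def power_mult_distrib)
  have along: "g (vertex 1) = h (\<sigma> (vertex 1))"
    if \<sigma>: "singular_simplex 1 X \<sigma>" and g: "continuous_on (standard_simplex 1) g"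
      "\<And>t. t \<in> standard_simplex 1 \<Longrightarrow> g t ^ 2 = f (\<sigma> t)" and g0: "g (vertex 0) = h (\<sigma> (vertex 0))"
    for \<sigma> g
  proof -
    have "g (vertex 1) ^ 2 = csqrt (f (\<sigma> (vertex 1))) ^ 2"
      using g(2) by simp
    then obtain e where e: "g (vertex 1) = bit_sign e * csqrt (f (\<sigma> (vertex 1)))"
      unfolding square_eq_iff_bit_sign by blast
    have "b (\<sigma> (vertex 0)) + b (\<sigma> (vertex 1)) = b (\<sigma> (vertex 0)) + e"
      using sign_change_eq[OF \<sigma> f(2) g g0[unfolded h_def] e] b[OF \<sigma>] by simp
    then show ?thesis
      using e by (simp add: h_def)
  qed
  obtain \<sigma> where \<sigma>: "singular_simplex 1 X \<sigma>" "\<sigma> (vertex 0) = x" "\<sigma> (vertex 1) = T x"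
    using path_simplex_exists[OF x] by blast
  have top: "\<sigma> t \<in> topspace X" if "t \<in> standard_simplex 1" for t
    using singular_simplex_in_topspace[OF \<sigma>(1) that] .
  have xX: "x \<in> topspace X"
    using path_component_in_topspace[OF x] by simp
  obtain g0 where g0: "continuous_on (standard_simplex 1) g0"
      "\<And>t. t \<in> standard_simplex 1 \<Longrightarrow> g0 t ^ 2 = f (\<sigma> t)"
    using continuous_sqrt_on_standard_simplex[of 1 "\<lambda>t. f (\<sigma> t)"]
        continuous_on_singular_simplex[OF \<sigma>(1) f(1)] f(2) top by auto
  have "h x ^ 2 = g0 (vertex 0) ^ 2"
    using g0(2) \<sigma>(2) by (simp add: h2)
  then obtain a where a: "h x = bit_sign a * g0 (vertex 0)"
    unfolding square_eq_iff_bit_sign by blast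
  \<comment> \<open>A change of sign keeps a root of f along the path and lets it start at
    \<open>h x\<close>.\<close>
  define g where "g = (\<lambda>t. bit_sign a * g0 t)"
  have g: "continuous_on (standard_simplex 1) g" "\<And>t. t \<in> standard_simplex 1 \<Longrightarrow> g t ^ 2 = f (\<sigma> t)"
    unfolding g_def using g0 by (auto intro!: continuous_intros simp: power_mult_distrib)
  have gx: "g (vertex 0) = h x" "g (vertex 1) = h (T x)"
    using along[OF \<sigma>(1) g] a \<sigma> by (simp_all add: g_def)
  have "h (T x) ^ 2 = (\<i> * h x) ^ 2"
    using f(3)[OF xX] by (simp add: h2 power_mult_distrib)
  then obtain e where e: "h (T x) = bit_sign e * (\<i> * h x)"
    unfolding square_eq_iff_bit_sign by blast
  \<comment> \<open>As f is odd, multiplication by a constant of square -1 turns a continuous root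
    along a path into one along its image under T.\<close>
  define k where "k = bit_sign e * \<i>"
  have k2: "k ^ 2 = - 1" by (simp add: k_def power_mult_distrib)
  have "k * g (vertex 1) = h (simplex_map 1 T \<sigma> (vertex 1))"
  proof (rule along)
    show "singular_simplex 1 X (simplex_map 1 T \<sigma>)"
      by (rule singular_simplex_simplex_map[OF \<sigma>(1) T(1)])
    show "continuous_on (standard_simplex 1) (\<lambda>t. k * g t)"
      by (intro continuous_intros g)
    show "(k * g t) ^ 2 = f (simplex_map 1 T \<sigma> t)" if "t \<in> standard_simplex 1" for t
      using g(2)[OF that] f(3)[OF top[OF that]] that
      by (simp add: power_mult_distrib k2 simplex_map_def)
    show "k * g (vertex 0) = h (simplex_map 1 T \<sigma> (vertex 0))"
      using e \<sigma> gx by (simp add: simplex_map_def k_def)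
  qed
  \<comment> \<open>The image path leads back to \<open>T (T x) = x\<close>, so the root returns
    multiplied by \<open>k ^ 2\<close>, which is -1.\<close>
  then have "k * (k * h x) = h x"
    using gx e \<sigma> T(2)[OF xX] by (simp add: simplex_map_def k_def)
  then have "h x = 0"
    using k2 by (simp add: power2_eq_square flip: mult.assoc)
  then show False
    using h2[of x] f(2)[OF xX] by simp
qed

section \<open>Transfer along isomorphisms of cohomology\<close>

lemma carrier_cohomology_group:
  "carrier (cohomology_group p X) = cohomology_class p X ` cocycles p X"
  by (auto simp: cohomology_group_def cohomology_class_def FactGroup_def RCOSETS_def cocycle_group_def)

lemma cohomology_class_eq: "cohomology_class p X c = (\<lambda>b \<sigma>. b \<sigma> + c \<sigma>) ` coboundaries p X"
  by (auto simp: cohomology_class_def r_coset_def cocycle_group_def)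

lemma zero_in_cocycles: "(\<lambda>_. 0) \<in> cocycles p X"
  by (simp add: cocycles_def cochains_def coboundary_def fun_eq_iff)

lemma zero_in_coboundaries_1: "(\<lambda>_. 0) \<in> coboundaries 1 X"
  unfolding coboundaries_1_iff by (auto simp: cochains_def intro!: exI[of _ "\<lambda>_. 0"])

lemma coboundaries_1_add:
  assumes "c \<in> coboundaries 1 X" "d \<in> coboundaries 1 X"
  shows "(\<lambda>\<sigma>. c \<sigma> + d \<sigma>) \<in> coboundaries 1 X"
proof -
  obtain a b where "\<forall>\<sigma>. singular_simplex 1 X \<sigma> \<longrightarrow> c \<sigma> = a (\<sigma> (vertex 0)) + a (\<sigma> (vertex 1))"
    "\<forall>\<sigma>. singular_simplex 1 X \<sigma> \<longrightarrow> d \<sigma> = b (\<sigma> (vertex 0)) + b (\<sigma> (vertex 1))"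
    using assms unfolding coboundaries_1_iff by blast
  then have "\<forall>\<sigma>. singular_simplex 1 X \<sigma> \<longrightarrow>
      c \<sigma> + d \<sigma> = (\<lambda>x. a x + b x) (\<sigma> (vertex 0)) + (\<lambda>x. a x + b x) (\<sigma> (vertex 1))"
    by (simp add: add_ac)
  moreover have "(\<lambda>\<sigma>. c \<sigma> + d \<sigma>) \<in> cochains 1 X"
    using assms unfolding coboundaries_1_iff cochains_def by auto
  ultimately show ?thesis
    unfolding coboundaries_1_iff by (intro conjI exI[of _ "\<lambda>x. a x + b x"])
qed

lemma cohomology_class_1_coboundary:
  assumes "c \<in> coboundaries 1 X"
  shows "cohomology_class 1 X c = coboundaries 1 X"
proof -
  \<comment> \<open>In characteristic 2, adding c twice gives back d.\<close>
  have "d \<in> (\<lambda>b \<sigma>. b \<sigma> + c \<sigma>) ` coboundaries 1 X" if "d \<in> coboundaries 1 X" for d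
    by (rule image_eqI[of _ _ "\<lambda>\<sigma>. d \<sigma> + c \<sigma>"])
      (use that assms in \<open>auto simp: add.assoc intro: coboundaries_1_add[simplified]\<close>)
  then show ?thesis
    using assms coboundaries_1_add unfolding cohomology_class_eq by blast
qed

text \<open>The bijection in degree 1 carries over the property of having a single class. The class
  of c is then the class of 0, that is, the set of coboundaries.\<close>

lemma first_cohomology_trivial_transfer:
  assumes "X \<simeq>\<^sub>2 Y" "cocycles 1 Y \<subseteq> coboundaries 1 Y"
  shows "cocycles 1 X \<subseteq> coboundaries 1 X"
proof
  fix c assume c: "c \<in> cocycles 1 X"
  obtain \<Phi> where \<Phi>: "bij_betw \<Phi> (carrier (cohomology_group 1 X)) (carrier (cohomology_group 1 Y))"
    using assms(1) unfolding same_mod2_cohomology_def cohomology_algebra_iso_def iso_def by blast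
  have "carrier (cohomology_group 1 Y) \<subseteq> {coboundaries 1 Y}"
    unfolding carrier_cohomology_group using assms(2) cohomology_class_1_coboundary by blast
  then have "\<Phi> A = coboundaries 1 Y" if "A \<in> carrier (cohomology_group 1 X)" for A
    using bij_betwE[OF \<Phi>] that by blast
  then have "A = B" if "A \<in> carrier (cohomology_group 1 X)" "B \<in> carrier (cohomology_group 1 X)" for A B
    using that bij_betw_imp_inj_on[OF \<Phi>] by (metis inj_onD)
  then have "cohomology_class 1 X c = cohomology_class 1 X (\<lambda>_. 0)"
    unfolding carrier_cohomology_group using c zero_in_cocycles by blast
  also have "\<dots> = coboundaries 1 X"
    by (rule cohomology_class_1_coboundary[OF zero_in_coboundaries_1])
  finally have "(\<lambda>b \<sigma>. b \<sigma> + c \<sigma>) ` coboundaries 1 X = coboundaries 1 X"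
    unfolding cohomology_class_eq .
  \<comment> \<open>c lies in its own class because 0 is a coboundary.\<close>
  moreover have "(\<lambda>\<sigma>. (0::bit) + c \<sigma>) \<in> (\<lambda>b \<sigma>. b \<sigma> + c \<sigma>) ` coboundaries 1 X"
    using zero_in_coboundaries_1[of X] by (intro image_eqI[of _ _ "\<lambda>_. 0"]) auto
  ultimately show "c \<in> coboundaries 1 X"
    by simp
qed

section \<open>Degree 0 and path components\<close>

lemma carrier_cohomology_group_0:
  "carrier (cohomology_group 0 X) = (\<lambda>c. {c}) ` cocycles 0 X"
  by (auto simp: carrier_cohomology_group cohomology_class_eq coboundaries_def)

text \<open>An indicator function as a 0-cochain. Applied to the empty set, to everything and to a
  path component, it yields the cocycles that are counted below.\<close>

definition component_cochain :: "'a topology \<Rightarrow> 'a set \<Rightarrow> ((nat \<Rightarrow> real) \<Rightarrow> 'a) \<Rightarrow> bit" where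
  "component_cochain X S \<sigma> = (if singular_simplex 0 X \<sigma> \<and> \<sigma> (vertex 0) \<in> S then 1 else 0)"

text \<open>A 1-simplex joins its ends by a path, so both ends lie in S or neither does, and the two
  values cancel mod 2.\<close>

lemma component_cochain_cocycle:
  assumes "\<And>x y. path_component_of X x y \<Longrightarrow> x \<in> S \<longleftrightarrow> y \<in> S"
  shows "component_cochain X S \<in> cocycles 0 X"
proof -
  have "coboundary 0 X (component_cochain X S) \<sigma> = 0" for \<sigma>
  proof (cases "singular_simplex 1 X \<sigma>")
    case True
    show ?thesis
      using assms[OF path_component_of_1_simplex[OF True]] True
      by (auto simp: coboundary_0_eq component_cochain_def singular_simplex_const singular_simplex_in_topspace)
  qed (simp add: coboundary_def)
  then show ?thesis
    by (auto simp: cocycles_def cochains_def component_cochain_def)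
qed

lemma component_cochain_inject:
  assumes "component_cochain X S = component_cochain X T"
  shows "topspace X \<inter> S = topspace X \<inter> T"
proof -
  have "x \<in> S \<longleftrightarrow> x \<in> T" if "x \<in> topspace X" for x
    using fun_cong[OF assms, of "\<lambda>_\<in>standard_simplex 0. x"] that
    by (simp add: component_cochain_def singular_simplex_const split: if_splits)
  then show ?thesis by blast
qed

text \<open>On a path the cocycle condition says that both ends have equal values, so a cocycle is
  constant on points.\<close>

lemma cocycles_0_path_connected:
  assumes "path_connected_space Y" "topspace Y \<noteq> {}"
  shows "cocycles 0 Y = {component_cochain Y {}, component_cochain Y UNIV}"
proof
  show "cocycles 0 Y \<subseteq> {component_cochain Y {}, component_cochain Y UNIV}"
  proof
    fix c assume c: "c \<in> cocycles 0 Y"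
    obtain y where y: "y \<in> topspace Y" using assms by blast
    let ?pt = "\<lambda>y. \<lambda>_\<in>standard_simplex 0. y"
    have "c \<tau> = c (?pt y)" if \<tau>: "singular_simplex 0 Y \<tau>" for \<tau>
    proof -
      have t: "\<tau> (vertex 0) \<in> topspace Y"
        using singular_simplex_in_topspace[OF \<tau>] by simp
      then obtain \<sigma> where \<sigma>: "singular_simplex 1 Y \<sigma>" "\<sigma> (vertex 0) = y" "\<sigma> (vertex 1) = \<tau> (vertex 0)"
        using path_simplex_exists[of Y y "\<tau> (vertex 0)"] assms(1) y
        by (auto simp: path_connected_space_iff_path_component)
      have "coboundary 0 Y c \<sigma> = 0"
        using c by (simp add: cocycles_def)
      then have "c (?pt y) = c (?pt (\<tau> (vertex 0)))"
        using \<sigma> unfolding coboundary_0_eq[OF \<sigma>(1)] bit_add_eq_0_iff by simp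
      moreover have "?pt (\<tau> (vertex 0)) = \<tau>"
        using \<tau> t by (intro singular_0_simplex_eqI[of Y] singular_simplex_const) auto
      ultimately show ?thesis by simp
    qed
    moreover have "c \<tau> = 0" if "\<not> singular_simplex 0 Y \<tau>" for \<tau>
      using c that by (simp add: cocycles_def cochains_def)
    ultimately have "c \<tau> = component_cochain Y (if c (?pt y) = 0 then {} else UNIV) \<tau>" for \<tau>
      by (cases "singular_simplex 0 Y \<tau>") (simp_all add: component_cochain_def)
    then have "c = component_cochain Y (if c (?pt y) = 0 then {} else UNIV)"
      by blast
    then show "c \<in> {component_cochain Y {}, component_cochain Y UNIV}"
      by (auto split: if_splits)
  qed
qed (auto intro: component_cochain_cocycle)

text \<open>Cocycles of degree 0 are counted. A nonempty path-connected space has exactly two; a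
  proper path component would supply a third, and an empty space has only one.\<close>

lemma path_connected_transfer:
  assumes "X \<simeq>\<^sub>2 Y" "path_connected_space Y" "topspace Y \<noteq> {}"
  shows "path_connected_space X" "topspace X \<noteq> {}"
proof -
  obtain \<Phi> where \<Phi>: "bij_betw \<Phi> (carrier (cohomology_group 0 X)) (carrier (cohomology_group 0 Y))"
    using assms(1) unfolding same_mod2_cohomology_def cohomology_algebra_iso_def iso_def by blast
  have Y: "carrier (cohomology_group 0 Y) = {{component_cochain Y {}}, {component_cochain Y UNIV}}"
    by (simp add: carrier_cohomology_group_0 cocycles_0_path_connected[OF assms(2,3)])
  have "component_cochain Y {} \<noteq> component_cochain Y UNIV"
    using component_cochain_inject[of Y "{}" UNIV] assms(3) by auto
  then have "card (carrier (cohomology_group 0 Y)) = 2"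
    unfolding Y by simp
  \<comment> \<open>Classes in degree 0 are singletons, since 0 is the only coboundary
    there.\<close>
  then have card: "card ((\<lambda>c. {c}) ` cocycles 0 X) = 2"
    using bij_betw_same_card[OF \<Phi>] by (simp add: carrier_cohomology_group_0)
  then have card: "card (cocycles 0 X) = 2"
    by (simp add: card_image)
  then have fin: "finite (cocycles 0 X)"
    by (intro card_ge_0_finite) simp
  show "path_connected_space X"
    unfolding path_connected_space_iff_path_component
  proof (intro ballI, rule ccontr)
    fix x y assume xy: "x \<in> topspace X" "y \<in> topspace X" "\<not> path_component_of X x y"
    let ?C = "Collect (path_component_of X x)"
    let ?S = "{component_cochain X {}, component_cochain X UNIV, component_cochain X ?C}"
    have "component_cochain X ?C \<in> cocycles 0 X"
      by (rule component_cochain_cocycle) (metis mem_Collect_eq path_component_of_sym path_component_of_trans)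
    then have "?S \<subseteq> cocycles 0 X"
      by (auto intro: component_cochain_cocycle)
    then have "card ?S \<le> 2"
      using card_mono[OF fin] unfolding card by blast
    have "x \<in> topspace X \<inter> ?C" "y \<notin> topspace X \<inter> ?C"
      using xy by (auto simp: path_component_of_refl)
    then have "component_cochain X ?C \<noteq> component_cochain X {}" "component_cochain X ?C \<noteq> component_cochain X UNIV"
      "component_cochain X UNIV \<noteq> component_cochain X {}"
      using xy component_cochain_inject[of X ?C "{}"] component_cochain_inject[of X ?C UNIV]
        component_cochain_inject[of X UNIV "{}"] by auto
    then have "card ?S = 3" by simp
    with \<open>card ?S \<le> 2\<close> show False
      by linarith
  qed
  show "topspace X \<noteq> {}"
  proof
    assume "topspace X = {}"
    then have "cocycles 0 X = {\<lambda>_. 0}"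
      by (auto simp: cocycles_def cochains_def coboundary_def singular_simplex_empty)
    then show False
      using card by simp
  qed
qed

section \<open>Schwarz genus at most 2\<close>

lemma Z2_action_involution:
  assumes "continuous_action Z2_group X act"
  shows "continuous_map X X (act 1)" "\<And>x. x \<in> topspace X \<Longrightarrow> act 1 (act 1 x) = x"
proof -
  interpret group_action Z2_group "topspace X" act
    using assms by (simp add: continuous_action_def)
  have 1: "1 \<in> carrier Z2_group"
    by (simp add: carrier_integer_mod_group)
  then show "continuous_map X X (act 1)"
    using assms by (simp add: continuous_action_def)
  fix x assume x: "x \<in> topspace X"
  have "act 1 (act 1 x) = act (1 \<otimes>\<^bsub>Z2_group\<^esub> 1) x"
    using composition_rule[OF x 1 1] by simp
  also have "1 \<otimes>\<^bsub>Z2_group\<^esub> 1 = \<one>\<^bsub>Z2_group\<^esub>"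
    by simp
  also have "act \<one>\<^bsub>Z2_group\<^esub> x = x"
    using id_eq_one x by (metis restrict_apply)
  finally show "act 1 (act 1 x) = x" .
qed

text \<open>For n = 2 the join is a closed polygon with four edges, mapped here onto the unit circle
  of the l1 norm. For smaller n the missing vertices have coordinate 0.\<close>

definition join_coords :: "(nat \<times> int \<Rightarrow> real) \<Rightarrow> complex" where
  "join_coords t = Complex (t (0, 0) - t (0, 1)) (t (1, 0) - t (1, 1))"

text \<open>If both coordinates vanish, t agrees on \<open>(i, 0)\<close> and \<open>(i, 1)\<close>.
  At most one of these values may be nonzero, so both are 0, against the total weight 1.\<close>

lemma join_coords_nonzero:
  assumes t: "t \<in> topspace (join_power n Z2_group)" and "n \<le> 2"
  shows "join_coords t \<noteq> 0"
proof
  assume "join_coords t = 0"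
  then have "t (i, 0) = t (i, 1)" if "i < 2" for i
    using that by (auto simp: join_coords_def less_2_cases_iff complex_eq_iff)
  then have "t (i, g) = 0" if "i < n" "g \<in> {0, 1}" for i g
    using t that assms(2) unfolding join_power_def
    by simp (metis insertE less_le_trans singletonD zero_neq_one)
  moreover have "carrier Z2_group = {0, 1}"
    by (auto simp: carrier_integer_mod_group)
  ultimately have "(\<Sum>v\<in>{..<n} \<times> carrier Z2_group. t v) = 0"
    by (intro sum.neutral) auto
  then show False
    using t by (simp add: join_power_def)
qed

text \<open>The generator exchanges the two vertices of each factor, which negates each
  difference.\<close>

lemma join_coords_action:
  assumes "t \<in> topspace (join_power n Z2_group)"
  shows "join_coords (join_power_action n Z2_group 1 t) = - join_coords t"
proof -
  have "inv\<^bsub>Z2_group\<^esub> 1 = 1"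
    by (rule group.inv_equality) (auto simp: carrier_integer_mod_group)
  then show ?thesis
    using assms by (simp add: join_power_action_def join_coords_def carrier_integer_mod_group complex_eq_iff)
qed

lemma continuous_map_join_coords: "continuous_map (join_power n Z2_group) euclidean join_coords"
proof -
  have "continuous_on UNIV join_coords"
    unfolding join_coords_def Complex_eq
    by (intro continuous_intros continuous_on_subset[OF continuous_on_product_coordinates]) auto
  then show ?thesis
    unfolding join_power_def euclidean_product_topology
    by (intro continuous_map_from_subtopology) simp
qed

lemma genus_ge_3_if_first_cohomology_trivial:
  assumes iso: "X \<simeq>\<^sub>2 Y" and Y: "path_connected_space Y" "topspace Y \<noteq> {}" "cocycles 1 Y \<subseteq> coboundaries 1 Y"
    and act: "continuous_action Z2_group X act"
  shows "3 \<le> schwarz_genus_free X Z2_group act \<and>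
         \<not> (\<exists>f. equivariant_map Z2_group X act circle antipodal_action f)"
proof
  \<comment> \<open>Both claims reduce to this: a map to the join is composed with
    \<open>join_coords\<close>, and a map to the circle is regarded as a map to the plane.\<close>
  have odd: False
    if "continuous_map X euclidean f" "\<And>x. x \<in> topspace X \<Longrightarrow> f x \<noteq> 0"
      "\<And>x. x \<in> topspace X \<Longrightarrow> f (act 1 x) = - f x" for f :: "'a \<Rightarrow> complex"
  proof -
    obtain x where x: "x \<in> topspace X"
      using path_connected_transfer(2)[OF iso Y(1,2)] by blast
    moreover have "act 1 x \<in> topspace X"
      using Z2_action_involution(1)[OF act] x by (auto simp: continuous_map_def)
    ultimately have "path_component_of X x (act 1 x)"
      using path_connected_transfer(1)[OF iso Y(1,2)] by (simp add: path_connected_space_iff_path_component)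
    then show False
      using no_odd_nonvanishing_function[OF first_cohomology_trivial_transfer[OF iso Y(3)]
          Z2_action_involution[OF act] that] by blast
  qed
  have 1: "1 \<in> carrier Z2_group"
    by (simp add: carrier_integer_mod_group)
  show "3 \<le> schwarz_genus_free X Z2_group act"
    unfolding schwarz_genus_free_def
  proof (rule Inf_greatest, clarify)
    fix n f assume f: "equivariant_map Z2_group X act (join_power n Z2_group) (join_power_action n Z2_group) f"
    have "\<not> n \<le> 2"
    proof
      assume n: "n \<le> 2"
      have top: "f x \<in> topspace (join_power n Z2_group)" if "x \<in> topspace X" for x
        using f that by (auto simp: equivariant_map_def continuous_map_def)
      show False
      proof (rule odd[of "join_coords \<circ> f"])
        show "continuous_map X euclidean (join_coords \<circ> f)"
          using f continuous_map_join_coords unfolding equivariant_map_def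
          by (blast intro: continuous_map_compose)
        show "(join_coords \<circ> f) x \<noteq> 0" if "x \<in> topspace X" for x
          using join_coords_nonzero[OF top[OF that] n] by simp
        show "(join_coords \<circ> f) (act 1 x) = - (join_coords \<circ> f) x" if "x \<in> topspace X" for x
          using join_coords_action[OF top[OF that]] f 1 that by (simp add: equivariant_map_def)
      qed
    qed
    then show "3 \<le> enat n"
      by (simp add: numeral_eq_enat)
  qed
  show "\<not> (\<exists>f. equivariant_map Z2_group X act circle antipodal_action f)"
  proof
    assume "\<exists>f. equivariant_map Z2_group X act circle antipodal_action f"
    then obtain f where f: "equivariant_map Z2_group X act circle antipodal_action f" ..
    then have top: "f x \<in> sphere 0 1" if "x \<in> topspace X" for x
      using that by (auto simp: equivariant_map_def continuous_map_def)
    show False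
    proof (rule odd[of f])
      show "continuous_map X euclidean f"
        using f by (simp add: equivariant_map_def continuous_map_in_subtopology)
      show "f x \<noteq> 0" if "x \<in> topspace X" for x
        using top[OF that] by auto
      show "f (act 1 x) = - f x" if "x \<in> topspace X" for x
        using top[OF that] f 1 that by (simp add: equivariant_map_def antipodal_action_def)
    qed
  qed
qed

section \<open>Charts of the Milnor manifolds\<close>

lemma topspace_quotient_topology: "topspace (quotient_topology X q) = q ` topspace X"
proof
  show "topspace (quotient_topology X q) \<subseteq> q ` topspace X"
    by (auto simp: topspace_def openin_quotient_topology)
  have "{x \<in> topspace X. q x \<in> q ` topspace X} = topspace X" by auto
  then have "openin (quotient_topology X q) (q ` topspace X)"
    by (simp add: openin_quotient_topology)
  then show "q ` topspace X \<subseteq> topspace (quotient_topology X q)"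
    by (rule openin_subset)
qed

lemma quotient_map_quotient_topology: "quotient_map X (quotient_topology X q) q"
  by (auto simp: quotient_map_def topspace_quotient_topology openin_quotient_topology)

section \<open>Complex projective space and its affine charts\<close>

lemma quotient_map_homogeneous:
  "quotient_map (top_of_set (nonzero_vectors n)) (complex_projective_space n) homogeneous"
  unfolding complex_projective_space_def by (rule quotient_map_quotient_topology)

lemma topspace_complex_projective_space:
  "topspace (complex_projective_space n) = homogeneous ` nonzero_vectors n"
  by (simp add: complex_projective_space_def topspace_quotient_topology)

lemma homogeneous_scale:
  assumes "c \<noteq> 0"
  shows "homogeneous (\<lambda>i. c * z i) = homogeneous z"
proof -
  have "(\<exists>d. v = (\<lambda>i. d * (c * z i)) \<and> d \<noteq> 0) \<longleftrightarrow> (\<exists>d. v = (\<lambda>i. d * z i) \<and> d \<noteq> 0)" for v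
  proof safe
    fix d :: complex assume "d \<noteq> 0"
    then show "\<exists>e. (\<lambda>i. d * (c * z i)) = (\<lambda>i. e * z i) \<and> e \<noteq> 0"
      using assms by (intro exI[of _ "d * c"]) (simp add: mult.assoc)
    show "\<exists>e. (\<lambda>i. d * z i) = (\<lambda>i. e * (c * z i)) \<and> e \<noteq> 0"
      using assms \<open>d \<noteq> 0\<close> by (intro exI[of _ "d / c"]) simp
  qed
  then show ?thesis
    by (simp add: homogeneous_def)
qed

text \<open>A section of \<open>homogeneous\<close> over the chart where coordinate k does not
  vanish; there the normalised representative is unique.\<close>

definition affine_rep :: "nat \<Rightarrow> (nat \<Rightarrow> complex) set \<Rightarrow> nat \<Rightarrow> complex" where
  "affine_rep k L = (THE z. z \<in> L \<and> z k = 1)"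

lemma affine_rep_homogeneous:
  assumes "z k \<noteq> 0"
  shows "affine_rep k (homogeneous z) = (\<lambda>i. z i / z k)"
  unfolding affine_rep_def
proof (rule the_equality)
  show "(\<lambda>i. z i / z k) \<in> homogeneous z \<and> z k / z k = 1"
    using assms by (auto simp: homogeneous_def intro!: exI[of _ "1 / z k"])
  show "v = (\<lambda>i. z i / z k)" if "v \<in> homogeneous z \<and> v k = 1" for v
    using that assms by (auto simp: homogeneous_def field_simps)
qed

lemma homogeneous_affine_rep:
  assumes "z k \<noteq> 0"
  shows "homogeneous (\<lambda>i. z i / z k) = homogeneous z"
  using homogeneous_scale[of "1 / z k" z] assms by simp

definition affine_chart :: "nat \<Rightarrow> nat \<Rightarrow> (nat \<Rightarrow> complex) set set" where
  "affine_chart n k = homogeneous ` {z \<in> nonzero_vectors n. z k \<noteq> 0}"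

text \<open>Nonvanishing of a coordinate is invariant under nonzero scaling, so it can be read off
  any representative.\<close>

lemma homogeneous_in_affine_chart:
  assumes "z \<in> nonzero_vectors n"
  shows "homogeneous z \<in> affine_chart n k \<longleftrightarrow> z k \<noteq> 0"
proof
  assume "homogeneous z \<in> affine_chart n k"
  then obtain v where v: "homogeneous z = homogeneous v" "v k \<noteq> 0"
    by (auto simp: affine_chart_def)
  have "v \<in> homogeneous z"
    unfolding v(1) by (auto simp: homogeneous_def intro!: exI[of _ 1])
  then show "z k \<noteq> 0"
    using v(2) by (auto simp: homogeneous_def)
qed (use assms in \<open>auto simp: affine_chart_def\<close>)

lemma continuous_on_coordinate [continuous_intros]:
  fixes S :: "('i \<Rightarrow> 'b::topological_space) set" and T :: "(('i \<Rightarrow> 'b) \<times> ('i \<Rightarrow> 'b)) set"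
  shows "continuous_on S (\<lambda>z. z i)" "continuous_on T (\<lambda>d. fst d i)" "continuous_on T (\<lambda>d. snd d i)"
  by (rule continuous_on_product_then_coordinatewise, intro continuous_intros)+

lemma affine_chart_preimage:
  "{z \<in> topspace (top_of_set (nonzero_vectors n)). homogeneous z \<in> affine_chart n k}
     = {z \<in> nonzero_vectors n. z k \<noteq> 0}"
  by (auto simp: homogeneous_in_affine_chart)

lemma openin_affine_chart: "openin (complex_projective_space n) (affine_chart n k)"
proof -
  have "continuous_on (nonzero_vectors n) (\<lambda>z. z k)"
    by (intro continuous_intros)
  then have "openin (top_of_set (nonzero_vectors n)) (nonzero_vectors n \<inter> (\<lambda>z. z k) -` (- {0}))"
    by (rule continuous_openin_preimage_gen) (simp add: open_Compl)
  also have "nonzero_vectors n \<inter> (\<lambda>z. z k) -` (- {0}) = {z \<in> nonzero_vectors n. z k \<noteq> 0}"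
    by auto
  finally show ?thesis
    using affine_chart_preimage[of n k]
    by (auto simp: complex_projective_space_def openin_quotient_topology affine_chart_def)
qed

text \<open>A quotient map restricted to the full preimage of an open set is again a quotient map,
  so continuity is checked on vectors, where the map is division by the k-th entry.\<close>

lemma continuous_map_affine_rep:
  "continuous_map (subtopology (complex_projective_space n) (affine_chart n k)) euclidean (affine_rep k)"
proof (rule continuous_compose_quotient_map)
  let ?A = "{z \<in> nonzero_vectors n. z k \<noteq> 0}"
  show "quotient_map (subtopology (top_of_set (nonzero_vectors n)) ?A)
      (subtopology (complex_projective_space n) (affine_chart n k)) homogeneous"
    by (rule quotient_map_restriction[OF quotient_map_homogeneous affine_chart_preimage])
      (simp add: openin_affine_chart)
  have "continuous_on ?A (\<lambda>z i. z i / z k)"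
    by (rule continuous_on_coordinatewise_then_product) (auto intro!: continuous_intros)
  then have "continuous_on ?A (affine_rep k \<circ> homogeneous)"
    by (rule continuous_on_eq) (simp add: affine_rep_homogeneous)
  moreover have "subtopology (top_of_set (nonzero_vectors n)) ?A = top_of_set ?A"
    by (simp add: subtopology_subtopology Int_absorb1)
  ultimately show "continuous_map (subtopology (top_of_set (nonzero_vectors n)) ?A) euclidean
      (affine_rep k \<circ> homogeneous)"
    by simp
qed

section \<open>Coordinates on the Milnor manifold\<close>

lemma topspace_complex_milnor_manifold:
  "topspace (complex_milnor_manifold r s) =
     {(homogeneous z, homogeneous w) | z w.
        z \<in> nonzero_vectors r \<and> w \<in> nonzero_vectors s \<and> (\<Sum>i\<le>s. z i * cnj (w i)) = 0}"
  by (auto simp: complex_milnor_manifold_def topspace_complex_projective_space)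

definition milnor_chart :: "nat \<Rightarrow> nat \<Rightarrow> nat \<Rightarrow> nat \<Rightarrow> ((nat \<Rightarrow> complex) set \<times> (nat \<Rightarrow> complex) set) set" where
  "milnor_chart r s j k = topspace (complex_milnor_manifold r s) \<inter> affine_chart r j \<times> affine_chart s k"

lemma openin_milnor_chart: "openin (complex_milnor_manifold r s) (milnor_chart r s j k)"
proof -
  let ?P = "prod_topology (complex_projective_space r) (complex_projective_space s)"
  have box: "openin ?P (affine_chart r j \<times> affine_chart s k)"
    by (simp add: openin_prod_Times_iff openin_affine_chart)
  have "topspace (subtopology ?P T) \<inter> A = T \<inter> A" if "openin ?P A" for T A
    using openin_subset[OF that] by auto
  then show ?thesis
    unfolding milnor_chart_def complex_milnor_manifold_def
    using openin_subtopology_Int2[OF box] box by (simp only:)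
qed

text \<open>The coordinates u are the conjugates of w, which makes the incidence relation bilinear.
  The k-th entry of z is not a coordinate: it is determined by the incidence relation.\<close>

definition milnor_coords :: "nat \<Rightarrow> nat \<Rightarrow> nat \<Rightarrow> nat \<Rightarrow> ((nat \<Rightarrow> complex) \<times> (nat \<Rightarrow> complex)) set" where
  "milnor_coords r s j k = {(z, u). (\<forall>i>r. z i = 0) \<and> (\<forall>i>s. u i = 0) \<and> z j = 1 \<and> u k = 1}"

text \<open>For \<open>u k = 1\<close> the incidence relation can be solved for the k-th entry of z.
  The old entry is discarded, so \<open>milnor_param\<close> is constant in it.\<close>

definition solve_incidence :: "nat \<Rightarrow> nat \<Rightarrow> (nat \<Rightarrow> complex) \<Rightarrow> (nat \<Rightarrow> complex) \<Rightarrow> nat \<Rightarrow> complex" where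
  "solve_incidence s k z u = z(k := - (\<Sum>i\<in>{..s} - {k}. z i * u i))"

definition milnor_param ::
  "nat \<Rightarrow> nat \<Rightarrow> (nat \<Rightarrow> complex) \<times> (nat \<Rightarrow> complex) \<Rightarrow> (nat \<Rightarrow> complex) set \<times> (nat \<Rightarrow> complex) set" where
  "milnor_param s k = (\<lambda>(z, u). (homogeneous (solve_incidence s k z u), homogeneous (\<lambda>i. cnj (u i))))"

definition milnor_coord_map ::
  "nat \<Rightarrow> nat \<Rightarrow> (nat \<Rightarrow> complex) set \<times> (nat \<Rightarrow> complex) set \<Rightarrow> (nat \<Rightarrow> complex) \<times> (nat \<Rightarrow> complex)" where
  "milnor_coord_map j k = (\<lambda>(L, M). (affine_rep j L, \<lambda>i. cnj (affine_rep k M i)))"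

text \<open>The line through d and e with a complex parameter. The contraction of a chart uses real
  parameters, the joining of points in an overlap complex ones.\<close>

definition line_point ::
  "(nat \<Rightarrow> complex) \<times> (nat \<Rightarrow> complex) \<Rightarrow> (nat \<Rightarrow> complex) \<times> (nat \<Rightarrow> complex) \<Rightarrow> complex
     \<Rightarrow> (nat \<Rightarrow> complex) \<times> (nat \<Rightarrow> complex)" where
  "line_point d e t = (\<lambda>i. fst d i + t * (fst e i - fst d i), \<lambda>i. snd d i + t * (snd e i - snd d i))"

lemma line_point_in_milnor_coords:
  "d \<in> milnor_coords r s j k \<Longrightarrow> e \<in> milnor_coords r s j k \<Longrightarrow> line_point d e t \<in> milnor_coords r s j k"
  by (auto simp: milnor_coords_def line_point_def)

lemma line_point_0 [simp]: "line_point d e 0 = d"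
  and line_point_1 [simp]: "line_point d e 1 = e"
  by (simp_all add: line_point_def)

lemma sum_solve_incidence:
  assumes "k \<le> s" "u k = 1"
  shows "(\<Sum>i\<le>s. solve_incidence s k z u i * u i) = 0"
proof -
  have "(\<Sum>i\<in>{..s} - {k}. solve_incidence s k z u i * u i) = (\<Sum>i\<in>{..s} - {k}. z i * u i)"
    by (rule sum.cong) (auto simp: solve_incidence_def)
  then show ?thesis
    using assms sum.remove[of "{..s}" k "\<lambda>i. solve_incidence s k z u i * u i"]
    by (simp add: solve_incidence_def)
qed

lemma solve_incidence_cancel:
  assumes "k \<le> s" "u k = 1" "(\<Sum>i\<le>s. z i * u i) = 0"
  shows "solve_incidence s k z u = z"
  using assms sum.remove[of "{..s}" k "\<lambda>i. z i * u i"]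
  by (simp add: solve_incidence_def fun_eq_iff add_eq_0_iff)

text \<open>As j differs from k, solving for entry k leaves the normalised entry
  \<open>z j = 1\<close> intact.\<close>

locale milnor_indices =
  fixes r s j k :: nat
  assumes le: "s \<le> r" "j \<le> r" "k \<le> s" and neq: "j \<noteq> k"
begin

lemma coords_nonzero:
  assumes "(z, u) \<in> milnor_coords r s j k"
  shows "solve_incidence s k z u \<in> nonzero_vectors r" "(\<lambda>i. cnj (u i)) \<in> nonzero_vectors s"
proof -
  have "solve_incidence s k z u j \<noteq> 0" "cnj (u k) \<noteq> 0"
    using assms neq by (auto simp: milnor_coords_def solve_incidence_def)
  then have "solve_incidence s k z u \<noteq> (\<lambda>_. 0)" "(\<lambda>i. cnj (u i)) \<noteq> (\<lambda>_. 0)"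
    by (metis, metis)
  then show "solve_incidence s k z u \<in> nonzero_vectors r" "(\<lambda>i. cnj (u i)) \<in> nonzero_vectors s"
    using assms le by (auto simp: nonzero_vectors_def milnor_coords_def solve_incidence_def)
qed

lemma param_in_manifold:
  assumes "d \<in> milnor_coords r s j k"
  shows "milnor_param s k d \<in> topspace (complex_milnor_manifold r s)"
proof -
  obtain z u where d: "d = (z, u)" by (cases d)
  \<comment> \<open>The second vector is the conjugate of u, so the conjugation in the incidence
    relation cancels.\<close>
  have "(\<Sum>i\<le>s. solve_incidence s k z u i * cnj (cnj (u i))) = 0"
    using assms le by (simp add: d milnor_coords_def sum_solve_incidence)
  then show ?thesis
    using coords_nonzero assms unfolding topspace_complex_milnor_manifold milnor_param_def d prod.case
    by blast
qed

lemma param_in_chart_iff: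
  assumes "(z, u) \<in> milnor_coords r s j k"
  shows "milnor_param s k (z, u) \<in> milnor_chart r s j' k' \<longleftrightarrow> solve_incidence s k z u j' \<noteq> 0 \<and> u k' \<noteq> 0"
  using param_in_manifold[OF assms] coords_nonzero[OF assms]
  by (simp add: milnor_chart_def milnor_param_def homogeneous_in_affine_chart)

lemma param_in_chart:
  assumes "d \<in> milnor_coords r s j k"
  shows "milnor_param s k d \<in> milnor_chart r s j k"
  using assms param_in_chart_iff[of "fst d" "snd d" j k] neq
  by (auto simp: milnor_coords_def solve_incidence_def)

lemma coord_map_inverse:
  assumes "p \<in> milnor_chart r s j k"
  shows "milnor_coord_map j k p \<in> milnor_coords r s j k"
    and "milnor_param s k (milnor_coord_map j k p) = p"
proof -
  obtain z w where p: "p = (homogeneous z, homogeneous w)" "z \<in> nonzero_vectors r" "w \<in> nonzero_vectors s"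
    and inc: "(\<Sum>i\<le>s. z i * cnj (w i)) = 0"
    using assms unfolding milnor_chart_def topspace_complex_milnor_manifold by blast
  then have nz: "z j \<noteq> 0" "w k \<noteq> 0"
    using assms by (auto simp: milnor_chart_def homogeneous_in_affine_chart)
  define u where "u = (\<lambda>i. cnj (w i / w k))"
  have map: "milnor_coord_map j k p = (\<lambda>i. z i / z j, u)"
    by (simp add: milnor_coord_map_def p(1) affine_rep_homogeneous nz u_def)
  then show "milnor_coord_map j k p \<in> milnor_coords r s j k"
    using p nz by (auto simp: milnor_coords_def nonzero_vectors_def u_def)
  \<comment> \<open>Rescaling preserves the incidence relation, so the k-th entry of the rescaled z
    already is the solved one.\<close>
  have "(\<Sum>i\<le>s. z i / z j * u i) = (\<Sum>i\<le>s. z i * cnj (w i)) / (z j * cnj (w k))"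
    by (simp add: u_def sum_divide_distrib)
  then have "solve_incidence s k (\<lambda>i. z i / z j) u = (\<lambda>i. z i / z j)"
    using inc nz le by (intro solve_incidence_cancel) (auto simp: u_def)
  then show "milnor_param s k (milnor_coord_map j k p) = p"
    unfolding map unfolding milnor_param_def p(1) prod.case
    using nz homogeneous_affine_rep[of z j] homogeneous_affine_rep[of w k] by (simp add: u_def)
qed

lemma continuous_param:
  "continuous_map (top_of_set (milnor_coords r s j k)) (complex_milnor_manifold r s) (milnor_param s k)"
proof -
  let ?D = "milnor_coords r s j k"
  have hom: "continuous_map (top_of_set (nonzero_vectors n)) (complex_projective_space n) homogeneous" for n
    using quotient_map_homogeneous by (rule quotient_imp_continuous_map)
  have "continuous_on ?D (\<lambda>d. solve_incidence s k (fst d) (snd d))"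
  proof (rule continuous_on_coordinatewise_then_product)
    show "continuous_on ?D (\<lambda>d. solve_incidence s k (fst d) (snd d) i)" for i
      unfolding solve_incidence_def by (cases "i = k") (auto intro!: continuous_intros)
  qed
  then have "continuous_map (top_of_set ?D) (top_of_set (nonzero_vectors r)) (\<lambda>d. solve_incidence s k (fst d) (snd d))"
    using coords_nonzero(1) by (auto simp: continuous_map_in_subtopology)
  note 1 = continuous_map_compose[OF this hom]
  have "continuous_on ?D (\<lambda>d i. cnj (snd d i))"
    by (rule continuous_on_coordinatewise_then_product) (intro continuous_intros)
  then have "continuous_map (top_of_set ?D) (top_of_set (nonzero_vectors s)) (\<lambda>d i. cnj (snd d i))"
    using coords_nonzero(2) by (auto simp: continuous_map_in_subtopology)
  note 2 = continuous_map_compose[OF this hom]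
  have "continuous_map (top_of_set ?D) (prod_topology (complex_projective_space r) (complex_projective_space s))
      (milnor_param s k)"
    using 1 2 by (simp add: continuous_map_pairwise milnor_param_def o_def case_prod_unfold)
  moreover have "milnor_param s k ` ?D \<subseteq> topspace (complex_milnor_manifold r s)"
    using param_in_manifold by blast
  ultimately show ?thesis
    unfolding complex_milnor_manifold_def
    by (auto simp: continuous_map_in_subtopology)
qed

lemma continuous_coord_map:
  "continuous_map (subtopology (complex_milnor_manifold r s) (milnor_chart r s j k))
     (top_of_set (milnor_coords r s j k)) (milnor_coord_map j k)"
proof -
  let ?Z = "subtopology (complex_milnor_manifold r s) (milnor_chart r s j k)"
  have prod: "continuous_map ?Z (prod_topology (complex_projective_space r) (complex_projective_space s)) id"
    by (simp add: complex_milnor_manifold_def continuous_map_from_subtopology)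
  have "continuous_map ?Z (complex_projective_space r) fst" "continuous_map ?Z (complex_projective_space s) snd"
    using continuous_map_compose[OF prod continuous_map_fst] continuous_map_compose[OF prod continuous_map_snd]
    by simp_all
  then have "continuous_map ?Z (subtopology (complex_projective_space r) (affine_chart r j)) fst"
    "continuous_map ?Z (subtopology (complex_projective_space s) (affine_chart s k)) snd"
    by (auto simp: continuous_map_in_subtopology milnor_chart_def)
  note 1 = this[THEN continuous_map_compose, OF continuous_map_affine_rep]
  have "continuous_on UNIV (\<lambda>v i. cnj (v i) :: complex)"
    by (rule continuous_on_coordinatewise_then_product) (intro continuous_intros)
  then have cnj: "continuous_map euclidean euclidean (\<lambda>v i. cnj (v i) :: complex)"
    by simp
  have "continuous_map ?Z (prod_topology euclidean euclidean) (milnor_coord_map j k)"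
    using continuous_map_pairedI[OF 1(1) continuous_map_compose[OF 1(2) cnj]]
    by (simp only: milnor_coord_map_def o_def case_prod_unfold)
  then show ?thesis
    using coord_map_inverse(1) by (auto simp: continuous_map_in_subtopology milnor_chart_def)
qed

text \<open>The chart is a retract of the affine set \<open>milnor_coords\<close>:
  \<open>milnor_coord_map\<close> embeds it and \<open>milnor_param\<close> maps back. A straight
  contraction of the affine set therefore induces one of the chart.\<close>

lemma contractible_chart:
  "contractible_space (subtopology (complex_milnor_manifold r s) (milnor_chart r s j k))"
proof -
  let ?Z = "subtopology (complex_milnor_manifold r s) (milnor_chart r s j k)"
  let ?D = "milnor_coords r s j k"
  define d where "d = ((\<lambda>i. if i = j then 1 else 0) :: nat \<Rightarrow> complex, (\<lambda>i. if i = k then 1 else 0) :: nat \<Rightarrow> complex)"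
  have d: "d \<in> ?D"
    using le by (auto simp: d_def milnor_coords_def)
  \<comment> \<open>The parameter \<open>1 - t\<close> starts at the given point and ends at the
    centre d.\<close>
  let ?l = "\<lambda>(t, e). line_point d e (complex_of_real (1 - t))"
  let ?h = "\<lambda>(t, p). milnor_param s k (line_point d (milnor_coord_map j k p) (complex_of_real (1 - t)))"
  have "continuous_on ({0..1} \<times> ?D) (\<lambda>x. fst (snd x) i)" "continuous_on ({0..1} \<times> ?D) (\<lambda>x. snd (snd x) i)" for i
    by (rule continuous_on_product_then_coordinatewise, intro continuous_intros)+
  note [continuous_intros] = this
  have "continuous_on ({0..1} \<times> ?D) ?l"
    unfolding line_point_def case_prod_unfold
    by (intro continuous_on_Pair continuous_on_coordinatewise_then_product) (intro continuous_intros)+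
  then have l: "continuous_map (prod_topology (top_of_set {0..1}) (top_of_set ?D)) (top_of_set ?D) ?l"
    using d by (auto simp: continuous_map_in_subtopology line_point_in_milnor_coords)
  have "continuous_map (prod_topology (top_of_set {0..1}) ?Z) (prod_topology (top_of_set {0..1}) (top_of_set ?D))
      (\<lambda>(t, p). (t, milnor_coord_map j k p))"
    using continuous_map_pairedI[OF continuous_map_fst continuous_map_compose[OF continuous_map_snd continuous_coord_map]]
    by (simp only: o_def case_prod_unfold)
  from continuous_map_compose[OF continuous_map_compose[OF this l] continuous_param]
  have "continuous_map (prod_topology (top_of_set {0..1}) ?Z) (complex_milnor_manifold r s) ?h"
    by (simp add: o_def case_prod_unfold)
  moreover have "?h x \<in> milnor_chart r s j k" if "x \<in> topspace (prod_topology (top_of_set {0..1}) ?Z)" for x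
    using that d by (auto intro!: param_in_chart line_point_in_milnor_coords coord_map_inverse(1))
  ultimately have "continuous_map (prod_topology (top_of_set {0..1}) ?Z) ?Z ?h"
    by (auto simp: continuous_map_in_subtopology)
  then have "homotopic_with (\<lambda>x. True) ?Z ?Z id (\<lambda>_. milnor_param s k d)"
    by (subst homotopic_with) (auto intro!: exI[of _ ?h] simp: coord_map_inverse(2))
  then show ?thesis
    unfolding contractible_space_def by blast
qed

text \<open>In the coordinates of one chart, membership in the other is the nonvanishing of a
  polynomial along the line. It does not vanish at t = 0, so it has finitely many roots.\<close>

lemma finite_line_outside_chart:
  assumes d: "d \<in> milnor_coords r s j k" and e: "e \<in> milnor_coords r s j k"
    and "milnor_param s k d \<in> milnor_chart r s j' k'"
  shows "finite {t. milnor_param s k (line_point d e t) \<notin> milnor_chart r s j' k'}"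
proof -
  let ?lin = "\<lambda>a b. [:a, b - a:] :: complex poly"
  define Z where "Z = (\<lambda>i. ?lin (fst d i) (fst e i))"
  define U where "U = (\<lambda>i. ?lin (snd d i) (snd e i))"
  \<comment> \<open>Entry j' of the solved vector as a polynomial in t: of degree at most 1, except
    for j' = k, where the incidence relation makes it at most quadratic.\<close>
  define Q where "Q = (if j' = k then - (\<Sum>i\<in>{..s} - {k}. Z i * U i) else Z j')"
  have l: "line_point d e t = (\<lambda>i. poly (Z i) t, \<lambda>i. poly (U i) t)" for t
    by (simp add: line_point_def Z_def U_def)
  have iff: "milnor_param s k (line_point d e t) \<in> milnor_chart r s j' k' \<longleftrightarrow> poly (Q * U k') t \<noteq> 0" for t
    using param_in_chart_iff[of "\<lambda>i. poly (Z i) t" "\<lambda>i. poly (U i) t" j' k']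
      line_point_in_milnor_coords[OF d e, of t]
    by (simp add: l Q_def solve_incidence_def poly_sum)
  have "poly (Q * U k') 0 \<noteq> 0"
    using iff[of 0] assms(3) by simp
  then have "Q * U k' \<noteq> 0"
    by (metis poly_0)
  then show ?thesis
    unfolding iff not_not by (rule poly_roots_finite)
qed

lemma path_connected_chart_Int:
  "path_connected_space (subtopology (complex_milnor_manifold r s) (milnor_chart r s j k \<inter> milnor_chart r s j' k'))"
  unfolding path_connected_space_iff_path_component
proof (intro ballI)
  let ?W = "milnor_chart r s j k \<inter> milnor_chart r s j' k'"
  let ?Z = "subtopology (complex_milnor_manifold r s) ?W"
  let ?D = "milnor_coords r s j k"
  fix p q assume "p \<in> topspace ?Z" "q \<in> topspace ?Z"
  then have p: "p \<in> milnor_chart r s j k" "p \<in> milnor_chart r s j' k'"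
    and q: "q \<in> milnor_chart r s j k" "q \<in> milnor_chart r s j' k'" by auto
  define d e where "d = milnor_coord_map j k p" "e = milnor_coord_map j k q"
  have de: "d \<in> ?D" "e \<in> ?D" "milnor_param s k d = p" "milnor_param s k e = q"
    using coord_map_inverse p(1) q(1) by (simp_all add: d_e_def)
  let ?\<gamma> = "\<lambda>t. milnor_param s k (line_point d e t)"
  \<comment> \<open>The parameters are complex because the plane, unlike the real line, stays
    path-connected when finitely many points are removed.\<close>
  define S where "S = {t. ?\<gamma> t \<in> milnor_chart r s j' k'}"
  have "- S = {t. ?\<gamma> t \<notin> milnor_chart r s j' k'}"
    by (auto simp: S_def)
  then have "finite (- S)"
    using finite_line_outside_chart[OF de(1,2)] de(3) p(2) by simp
  then have "path_connected S"
    using path_connected_complement_countable[of "- S"] by (simp add: countable_finite)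
  then have pcS: "path_connectedin (top_of_set S) S"
    by (simp add: path_connectedin_subtopology)
  have "continuous_on S (line_point d e)"
    unfolding line_point_def
    by (intro continuous_on_Pair continuous_on_coordinatewise_then_product) (intro continuous_intros)+
  then have "continuous_map (top_of_set S) (top_of_set ?D) (line_point d e)"
    using line_point_in_milnor_coords[OF de(1,2)] by (auto simp: continuous_map_in_subtopology)
  from continuous_map_compose[OF this continuous_param]
  have "continuous_map (top_of_set S) ?Z ?\<gamma>"
    using param_in_chart line_point_in_milnor_coords[OF de(1,2)]
    by (auto simp: continuous_map_in_subtopology o_def S_def)
  then have pc: "path_connectedin ?Z (?\<gamma> ` S)"
    using pcS by (rule path_connectedin_continuous_map_image)
  have "0 \<in> S" "1 \<in> S"
    using p(2) q(2) by (simp_all add: S_def de(3,4))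
  then have "?\<gamma> 0 \<in> ?\<gamma> ` S" "?\<gamma> 1 \<in> ?\<gamma> ` S"
    by blast+
  then have "p \<in> ?\<gamma> ` S" "q \<in> ?\<gamma> ` S"
    by (simp_all only: line_point_0 line_point_1 de(3,4))
  then show "path_component_of ?Z p q"
    using path_component_of_maximal[OF pc, of p] by blast
qed

end

section \<open>The atlas and its consequences\<close>

definition milnor_atlas :: "nat \<Rightarrow> nat \<Rightarrow> ((nat \<Rightarrow> complex) set \<times> (nat \<Rightarrow> complex) set) set set" where
  "milnor_atlas r s = {milnor_chart r s j k | j k. j \<le> r \<and> k \<le> s \<and> j \<noteq> k}"

text \<open>Some \<open>w k\<close> is nonzero. If z vanished outside entry k, the incidence
  relation would reduce to \<open>z k * cnj (w k) = 0\<close> and force z = 0; hence a suitable j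
  exists.\<close>

lemma milnor_atlas_cover:
  assumes "s \<le> r"
  shows "topspace (complex_milnor_manifold r s) \<subseteq> \<Union>(milnor_atlas r s)"
proof
  fix p assume p: "p \<in> topspace (complex_milnor_manifold r s)"
  then obtain z w where zw: "p = (homogeneous z, homogeneous w)" "z \<in> nonzero_vectors r" "w \<in> nonzero_vectors s"
    and inc: "(\<Sum>i\<le>s. z i * cnj (w i)) = 0"
    unfolding topspace_complex_milnor_manifold by blast
  obtain k where k: "w k \<noteq> 0" "k \<le> s"
    using zw(3) by (force simp: nonzero_vectors_def fun_eq_iff not_le)
  have "\<exists>j. j \<noteq> k \<and> z j \<noteq> 0"
  proof (rule ccontr)
    assume "\<not> (\<exists>j. j \<noteq> k \<and> z j \<noteq> 0)"
    then have z: "z j = 0" if "j \<noteq> k" for j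
      using that by blast
    then have "(\<Sum>i\<le>s. z i * cnj (w i)) = z k * cnj (w k)"
      using k(2) sum.remove[of "{..s}" k "\<lambda>i. z i * cnj (w i)"] by simp
    then have "z = (\<lambda>_. 0)"
      using inc k(1) z by (metis complex_cnj_zero_iff mult_eq_0_iff)
    then show False
      using zw(2) by (simp add: nonzero_vectors_def)
  qed
  then obtain j where j: "j \<noteq> k" "z j \<noteq> 0" by blast
  then have "j \<le> r"
    using zw(2) by (force simp: nonzero_vectors_def not_le)
  moreover have "p \<in> milnor_chart r s j k"
    using p zw j k by (simp add: milnor_chart_def homogeneous_in_affine_chart)
  ultimately show "p \<in> \<Union>(milnor_atlas r s)"
    using j k by (auto simp: milnor_atlas_def)
qed

lemma milnor_atlas_common_point:
  assumes "1 \<le> s" "s \<le> r"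
  obtains p where "p \<in> topspace (complex_milnor_manifold r s)" "\<And>U. U \<in> milnor_atlas r s \<Longrightarrow> p \<in> U"
proof
  \<comment> \<open>The incidence sum has s terms equal to 1 and the term -s. As s is positive, no
    coordinate in range vanishes, so the point lies in every chart.\<close>
  define z :: "nat \<Rightarrow> complex" where "z = (\<lambda>i. if r < i then 0 else if i = s then - of_nat s else 1)"
  define w :: "nat \<Rightarrow> complex" where "w = (\<lambda>i. if i \<le> s then 1 else 0)"
  let ?p = "(homogeneous z, homogeneous w)"
  have nz: "z i \<noteq> 0" if "i \<le> r" for i
    using assms that by (simp add: z_def)
  have "z 0 \<noteq> 0" "w 0 \<noteq> 0"
    using nz[of 0] by (simp_all add: w_def)
  then have zw: "z \<in> nonzero_vectors r" "w \<in> nonzero_vectors s"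
    by (auto simp: nonzero_vectors_def z_def w_def fun_eq_iff)
  have "(\<Sum>i\<le>s. z i * cnj (w i)) = (\<Sum>i<s. z i * cnj (w i)) + z s * cnj (w s)"
    by (simp add: lessThan_Suc flip: lessThan_Suc_atMost)
  also have "(\<Sum>i<s. z i * cnj (w i)) = (\<Sum>i<s. 1)"
    using assms by (intro sum.cong) (auto simp: z_def w_def)
  also have "\<dots> + z s * cnj (w s) = 0"
    using assms by (simp add: z_def w_def)
  finally have "(\<Sum>i\<le>s. z i * cnj (w i)) = 0" .
  then show p: "?p \<in> topspace (complex_milnor_manifold r s)"
    using zw unfolding topspace_complex_milnor_manifold by blast
  show "?p \<in> U" if "U \<in> milnor_atlas r s" for U
    using that p zw nz by (auto simp: milnor_atlas_def milnor_chart_def homogeneous_in_affine_chart w_def)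
qed

lemma milnor_atlas:
  assumes "s \<le> r" "U \<in> milnor_atlas r s" "V \<in> milnor_atlas r s"
  shows "openin (complex_milnor_manifold r s) U"
    and "contractible_space (subtopology (complex_milnor_manifold r s) U)"
    and "path_connected_space (subtopology (complex_milnor_manifold r s) (U \<inter> V))"
proof -
  obtain j k where U: "U = milnor_chart r s j k" "j \<le> r" "k \<le> s" "j \<noteq> k"
    using assms(2) by (auto simp: milnor_atlas_def)
  obtain j' k' where V: "V = milnor_chart r s j' k'"
    using assms(3) by (auto simp: milnor_atlas_def)
  interpret milnor_indices r s j k
    using assms(1) U by unfold_locales
  show "openin (complex_milnor_manifold r s) U"
    "contractible_space (subtopology (complex_milnor_manifold r s) U)"
    "path_connected_space (subtopology (complex_milnor_manifold r s) (U \<inter> V))"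
    unfolding U(1) V by (rule openin_milnor_chart contractible_chart path_connected_chart_Int)+
qed

lemma path_connected_milnor_manifold:
  assumes "1 \<le> s" "s \<le> r"
  shows "path_connected_space (complex_milnor_manifold r s)"
proof -
  let ?Y = "complex_milnor_manifold r s"
  obtain p where p: "p \<in> topspace ?Y" "\<And>U. U \<in> milnor_atlas r s \<Longrightarrow> p \<in> U"
    using milnor_atlas_common_point[OF assms] by blast
  have "path_component_of ?Y p q" if q: "q \<in> topspace ?Y" for q
  proof -
    obtain U where U: "U \<in> milnor_atlas r s" "q \<in> U"
      using milnor_atlas_cover[OF assms(2)] q by blast
    \<comment> \<open>The overlap of a chart with itself is the chart, so path-connected overlaps
      include single charts.\<close>
    have "path_connectedin ?Y U"
      using milnor_atlas[OF assms(2) U(1) U(1)] by (simp add: path_connectedin_def openin_subset)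
    then show ?thesis
      using path_component_of_maximal[OF _ p(2)[OF U(1)]] U(2) by blast
  qed
  then show ?thesis
    unfolding path_connected_space_iff_path_component
    by (meson path_component_of_sym path_component_of_trans)
qed

lemma first_cohomology_milnor_manifold_trivial:
  assumes "1 \<le> s" "s \<le> r"
  shows "cocycles 1 (complex_milnor_manifold r s) \<subseteq> coboundaries 1 (complex_milnor_manifold r s)"
proof
  let ?Y = "complex_milnor_manifold r s"
  fix c assume c: "c \<in> cocycles 1 ?Y"
  obtain p where p: "p \<in> topspace ?Y" "\<And>U. U \<in> milnor_atlas r s \<Longrightarrow> p \<in> U"
    using milnor_atlas_common_point[OF assms] by blast
  \<comment> \<open>The common point of the charts serves as the base point of the
    potential.\<close>
  obtain b where "\<And>\<sigma>. singular_simplex 1 ?Y \<sigma> \<Longrightarrow> c \<sigma> = b (\<sigma> (vertex 0)) + b (\<sigma> (vertex 1))"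
    by (rule cocycle_potential_of_cover[OF c _ milnor_atlas_cover[OF assms(2)] _ _ p(1)])
      (use milnor_atlas[OF assms(2)] p(2) in blast)+
  then show "c \<in> coboundaries 1 ?Y"
    using c unfolding coboundaries_1_iff cocycles_def by blast
qed

theorem proposition7p5:
  fixes X :: "'a topology" and act :: "int \<Rightarrow> 'a \<Rightarrow> 'a" and r s :: nat
  assumes "1 \<le> s" and "s \<le> r"
    and "compact_space X" and "Hausdorff_space X"
    and "X \<simeq>\<^sub>2 complex_milnor_manifold r s"
    and "free_continuous_action Z2_group X act"
  shows "3 \<le> schwarz_genus_free X Z2_group act \<and>
         \<not> (\<exists>f. equivariant_map Z2_group X act circle antipodal_action f)"
proof (rule genus_ge_3_if_first_cohomology_trivial)
  show "path_connected_space (complex_milnor_manifold r s)"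
    using assms(1,2) by (rule path_connected_milnor_manifold)
  show "topspace (complex_milnor_manifold r s) \<noteq> {}"
    using milnor_atlas_common_point[OF assms(1,2)] by blast
  show "cocycles 1 (complex_milnor_manifold r s) \<subseteq> coboundaries 1 (complex_milnor_manifold r s)"
    using assms(1,2) by (rule first_cohomology_milnor_manifold_trivial)
  show "continuous_action Z2_group X act"
    using assms(6) by (simp add: free_continuous_action_def)
qed (rule assms(5))

end
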